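(* Let $n$ be a positive integer and let $k,m,a,\alpha$ be complex numbers with $\alpha\neq 0$ such that all the functions below are defined. Then $$\sum _{p=0}^{n-1} (-1)^p e^{-\frac{i m p \pi }{n \alpha }} \Big(e^{\frac{i m (1-2 n+2 p) \pi }{n \alpha }}\, \Phi \left(e^{-\frac{2 i m \pi }{\alpha }},-k,1-\tfrac{1+2 p}{4 n}+\tfrac{a \alpha }{2}\right)-\Phi \left(e^{-\frac{2 i m \pi }{\alpha }},-k,\tfrac{1+2 p+2 a n \alpha }{4 n}\right)$$ $$-e^{\frac{2 i m \pi }{\alpha }}\, \Phi \left(e^{\frac{2 i m \pi }{\alpha }},-k,1-\tfrac{1+2 p}{4 n}+\tfrac{a \alpha }{2}\right)+e^{\frac{i m (1+2 p) \pi }{n \alpha }}\, \Phi \left(e^{\frac{2 i m \pi }{\alpha }},-k,\tfrac{1+2 p+2 a n \alpha }{4 n}\right)\Big)$$ $$=\left(\frac{1}{2 n}\right)^k \left(-\Phi \left(-e^{-\frac{i m \pi }{n \alpha }},-k,\tfrac{1}{2}+a n \alpha \right)+e^{\frac{i m \pi }{n \alpha }}\, \Phi \left(-e^{\frac{i m \pi }{n \alpha }},-k,\tfrac{1}{2}+a n \alpha \right)\right).$$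
   Context: $\Phi(z,s,v)$ is the Hurwitz–Lerch zeta function: $\Phi(z,s,v)=\sum_{j=0}^{\infty}\frac{z^j}{(j+v)^s}$ for $v\notin\{0,-1,-2,\dots\}$ and $|z|<1$ (or $|z|=1$, $\operatorname{Re}s>1$), and by analytic continuation (principal branch, cut along $z\in[1,\infty)$) for other values; $\Phi(1,s,v)$ is the Hurwitz zeta function $\zeta(s,v)$. Powers are principal values. *)

theory Defs
  imports "HOL-Complex_Analysis.Complex_Analysis"
begin

definition lerch_series :: "complex \<Rightarrow> complex \<Rightarrow> complex \<Rightarrow> complex" where
  "lerch_series z s v = (\<Sum>j. z ^ j / (of_nat j + v) powr s)"

(* Analytic continuation in s, for fixed v, from Re s > 1 to the plane punctured at the pole s = 1. *)
definition hurwitz_zeta :: "complex \<Rightarrow> complex \<Rightarrow> complex" where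
  "hurwitz_zeta s v =
     (THE y. \<exists>f. f holomorphic_on - {1} \<and>
                 (\<forall>s'. Re s' > 1 \<longrightarrow> f s' = lerch_series 1 s' v) \<and> f s = y)"

(* For z \<noteq> 1, the continuation is in z, for fixed s and v, from the unit disc to the plane
   cut along [1, \<infinity>).  The point z = 1 lies on that cut, and there the continuation is in s. *)
definition lerch_phi :: "complex \<Rightarrow> complex \<Rightarrow> complex \<Rightarrow> complex" where
  "lerch_phi z s v =
     (if norm z < 1 \<or> norm z = 1 \<and> Re s > 1 then lerch_series z s v
      else if z = 1 then hurwitz_zeta s v
      else (THE y. \<exists>f. f holomorphic_on - (complex_of_real ` {1..}) \<and>
                       (\<forall>z'. norm z' < 1 \<longrightarrow> f z' = lerch_series z' s v) \<and> f z = y))"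

(* The arguments at which lerch_phi is a genuine value: off the open cut (1, \<infinity>), and, at the
   branch point z = 1, away from the pole s = 1 of the Hurwitz zeta function. *)
definition lerch_defined :: "complex \<Rightarrow> complex \<Rightarrow> complex \<Rightarrow> bool" where
  "lerch_defined z s v \<longleftrightarrow>
     v \<notin> \<int>\<^sub>\<le>\<^sub>0 \<and> z \<notin> complex_of_real ` {1<..} \<and> \<not> (z = 1 \<and> s = 1)"

end

theory Submission
  imports Defs "HOL-Real_Asymp.Real_Asymp"
begin

text \<open>The identity is the multiplication formula
  \<open>(\<Sum>r<N. z ^ r * \<Phi>(z ^ N, s, (v + r) / N)) = N powr s * \<Phi>(z, s, v)\<close>
  with \<open>N = 2 n\<close>, \<open>s = - k\<close> and \<open>v = 1/2 + a n \<alpha>\<close>, used for \<open>z = - q\<close> and for \<open>z = - 1/q\<close>, where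
  \<open>q = exp (\<i> m pi / (n \<alpha>))\<close>. The parameters in the \<open>p\<close>-th summand are \<open>(v + r) / N\<close> for \<open>r = p\<close> and for
  \<open>r = 2 n - 1 - p\<close>, so the sum over \<open>p < n\<close> with its four terms runs through all residues \<open>r < 2 n\<close> for
  both values of \<open>z\<close> (lemma \<open>alternating_sum_pairing\<close>).

  Where the Lerch series converges, the multiplication formula sorts its terms by the residue of the
  index modulo \<open>N\<close>. Beyond that, \<open>\<Phi>\<close> is an analytic continuation, and this continuation has to be shown to
  exist before the formula can be transported to it by the identity theorem. Three situations occur.

  \<^item> If \<open>z ^ N\<close> lies off the cut \<open>[1, \<infinity>)\<close>, everything happens in the variable \<open>z\<close>. For \<open>Re s > 1\<close> and \<open>Re v > 0\<close> the
    continuation is the integral of \<open>t powr (s - 1) * exp (- v t) / (1 - z exp (- t))\<close> over \<open>t > 0\<close>, divided by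
    \<open>Gamma s\<close>; the operator \<open>v + z d/dz\<close>, which lowers the exponent by one, supplies the other exponents
    (\<open>lerch_slit_plane_continuation\<close>). The points \<open>z\<close> with \<open>z ^ N\<close> off the cut form a star-shaped set, so the
    formula spreads from the disc to all of them.

  \<^item> If \<open>z = 1\<close>, both sides are Hurwitz zeta functions and the variable is \<open>s\<close>. Their continuation comes from
    Taylor expansion of \<open>(j + v + 1) powr (-s)\<close> about \<open>j + v\<close>, which expresses \<open>(s - 1) \<zeta>(s, v)\<close> through values of
    \<open>\<zeta>\<close> further to the right and a remainder series (\<open>hurwitz_continuation\<close>).

  \<^item> If \<open>z \<noteq> 1\<close> but \<open>z ^ N = 1\<close>, the left-hand side consists of Hurwitz zeta functions, continued in \<open>s\<close>, while
    the right-hand side is continued in \<open>z\<close>. The bridge is a function on the closed unit disc without \<open>1\<close> that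
    is holomorphic in \<open>s\<close> and continuous in \<open>z\<close> (\<open>lerch_closed_disc_continuation\<close>), obtained from the
    same Taylor expansion; it agrees with both continuations (\<open>lerch_phi_unit_circle_by_exponent\<close>).\<close>

section \<open>Series of holomorphic functions and bounds on complex powers\<close>

lemma holomorphic_on_suminf:
  fixes f :: "nat \<Rightarrow> complex \<Rightarrow> complex"
  assumes "open A" "\<And>n. f n holomorphic_on A"
    and bnd: "\<And>K. compact K \<Longrightarrow> K \<subseteq> A \<Longrightarrow> \<exists>M. summable M \<and> (\<forall>n. \<forall>x\<in>K. norm (f n x) \<le> M n)"
  shows "(\<lambda>x. \<Sum>n. f n x) holomorphic_on A"
proof (rule holomorphic_uniform_sequence[OF \<open>open A\<close>])
  show "(\<lambda>x. \<Sum>i<n. f i x) holomorphic_on A" for n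
    using assms(2) by (intro holomorphic_intros)
  show "\<exists>d>0. cball x d \<subseteq> A \<and>
          uniform_limit (cball x d) (\<lambda>n x. \<Sum>i<n. f i x) (\<lambda>x. \<Sum>n. f n x) sequentially"
    if x: "x \<in> A" for x
  proof -
    obtain d where d: "d > 0" "cball x d \<subseteq> A"
      using open_contains_cball_eq[OF \<open>open A\<close>] x by metis
    obtain M where M: "summable M" "\<forall>n. \<forall>y\<in>cball x d. norm (f n y) \<le> M n"
      using bnd[OF compact_cball d(2)] by metis
    have "uniform_limit (cball x d) (\<lambda>n x. \<Sum>i<n. f i x) (\<lambda>x. \<Sum>n. f n x) sequentially"
      by (rule Weierstrass_m_test[of _ _ M]) (use M in auto)
    then show ?thesis
      using d by blast
  qed
qed

lemma continuous_on_suminf: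
  fixes f :: "nat \<Rightarrow> 'a::topological_space \<Rightarrow> complex"
  assumes "\<And>n. continuous_on A (f n)" "summable M" "\<And>n x. x \<in> A \<Longrightarrow> norm (f n x) \<le> M n"
  shows "continuous_on A (\<lambda>x. \<Sum>n. f n x)"
proof (rule uniform_limit_theorem)
  show "uniform_limit A (\<lambda>n x. \<Sum>i<n. f i x) (\<lambda>x. \<Sum>n. f n x) sequentially"
    by (rule Weierstrass_m_test[of _ _ M]) (use assms in auto)
  show "\<forall>\<^sub>F n in sequentially. continuous_on A (\<lambda>x. \<Sum>i<n. f i x)"
    using assms(1) by (intro always_eventually allI continuous_on_sum)
qed auto

lemma plus_of_nat_nonzero:
  fixes v :: complex
  assumes "v \<notin> \<int>\<^sub>\<le>\<^sub>0" shows "of_nat j + v \<noteq> 0"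
proof
  assume "of_nat j + v = 0"
  then have "v = - of_nat j" by (simp add: add_eq_0_iff)
  then show False using assms by simp
qed

text \<open>The argument of \<open>x\<close> enters the modulus of a complex power only through the factor
  \<open>exp (Im s * Arg x)\<close>, which is bounded on horizontal strips. Making \<open>\<sigma>\<close> and \<open>B\<close> independent
  of \<open>s\<close> yields majorants that are uniform on compact sets of exponents.\<close>

lemma norm_powr_minus_le:
  assumes "norm x \<ge> 1" "\<sigma> \<le> Re s" "\<bar>Im s\<bar> \<le> B"
  shows "norm (x powr (-s)) \<le> exp (pi * B) * norm x powr (-\<sigma>)"
proof -
  have "Im s * Arg x \<le> \<bar>Im s\<bar> * \<bar>Arg x\<bar>"
    by (metis abs_ge_self abs_mult)
  also have "\<dots> \<le> B * pi"
    using assms Arg_bounded[of x] by (intro mult_mono) auto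
  finally have "exp (Im s * Arg x) \<le> exp (pi * B)" by (simp add: mult.commute)
  moreover have "norm x powr (- Re s) \<le> norm x powr (-\<sigma>)"
    using assms by (intro powr_mono) auto
  ultimately have "norm x powr (- Re s) * exp (Im s * Arg x) \<le> norm x powr (-\<sigma>) * exp (pi * B)"
    by (intro mult_mono) auto
  then show ?thesis by (simp add: norm_powr_complex mult.commute)
qed

lemma norm_plus_of_nat_ge:
  assumes "Re v \<ge> 1" shows "norm (of_nat j + v) \<ge> real j + 1"
  using complex_Re_le_cmod[of "of_nat j + v"] assms by simp

lemma summable_Suc_powr:
  assumes "\<sigma> > 1" shows "summable (\<lambda>j. (real j + 1) powr (-\<sigma>))"
proof -
  have "summable (\<lambda>j. real (Suc j) powr (-\<sigma>))"
    using assms summable_real_powr_iff[of "-\<sigma>"] by (subst summable_Suc_iff) simp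
  then show ?thesis by (simp add: add.commute)
qed

section \<open>The Lerch series\<close>

lemma lerch_term_summable:
  assumes "norm z \<le> 1" "Re s > 1"
  shows "summable (\<lambda>j. norm (z ^ j / (of_nat j + v) powr s))"
proof -
  obtain K :: nat where K: "real K \<ge> 1 - Re v" using real_nat_ceiling_ge by blast
  have *: "norm (norm (z ^ (j + K) / (of_nat (j + K) + v) powr s))
           \<le> exp (pi * \<bar>Im s\<bar>) * (real j + 1) powr (-Re s)" for j
  proof -
    let ?x = "of_nat j + (of_nat K + v) :: complex"
    have x: "norm ?x \<ge> real j + 1" by (rule norm_plus_of_nat_ge) (use K in simp)
    have "norm (z ^ (j + K) / ?x powr s) = norm z ^ (j + K) * norm (?x powr (-s))"
      by (simp add: norm_divide norm_mult norm_power powr_minus_divide)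
    also have "\<dots> \<le> 1 * (exp (pi * \<bar>Im s\<bar>) * norm ?x powr (-Re s))"
      using x assms by (intro mult_mono norm_powr_minus_le power_le_one) auto
    also have "norm ?x powr (-Re s) \<le> (real j + 1) powr (-Re s)"
      using x assms by (intro powr_mono2') auto
    finally show ?thesis by (simp add: add.assoc)
  qed
  have "summable (\<lambda>j. norm (z ^ (j + K) / (of_nat (j + K) + v) powr s))"
    by (rule summable_comparison_test[OF _ summable_mult[OF summable_Suc_powr[OF assms(2)],
          of "exp (pi * \<bar>Im s\<bar>)"]]) (use * in auto)
  then show ?thesis
    using summable_iff_shift[of "\<lambda>j. norm (z ^ j / (of_nat j + v) powr s)" K] by simp
qed

text \<open>The operator \<open>v + z d/dz\<close> multiplies the \<open>j\<close>-th coefficient of a power series by \<open>j + v\<close>.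
  Applied to the Lerch series of exponent \<open>s + 1\<close> it therefore produces the one of exponent \<open>s\<close>; this
  is how statements about large \<open>Re s\<close> descend to all exponents.\<close>

lemma euler_operator_power_series:
  fixes c :: "nat \<Rightarrow> complex"
  assumes "\<And>z. norm z < 1 \<Longrightarrow> summable (\<lambda>j. c j * z ^ j)" and "norm z < 1"
  shows "(\<lambda>j. (of_nat j + v) * c j * z ^ j) sums
           (v * (\<Sum>j. c j * z ^ j) + z * deriv (\<lambda>z. \<Sum>j. c j * z ^ j) z)"
proof -
  have d: "deriv (\<lambda>z. \<Sum>j. c j * z ^ j) z = (\<Sum>j. diffs c j * z ^ j)"
    by (rule DERIV_imp_deriv, rule termdiffs_strong'[of 1 c z]) (use assms in auto)
  have "summable (\<lambda>j. diffs c j * z ^ j)"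
    using assms by (intro termdiff_converges[of z 1]) auto
  then have "(\<lambda>j. z * (diffs c j * z ^ j)) sums (z * deriv (\<lambda>z. \<Sum>j. c j * z ^ j) z)"
    unfolding d by (intro sums_mult summable_sums)
  also have "(\<lambda>j. z * (diffs c j * z ^ j)) = (\<lambda>j. of_nat (Suc j) * c (Suc j) * z ^ Suc j)"
    by (simp add: diffs_def fun_eq_iff)
  finally have "(\<lambda>j. of_nat j * c j * z ^ j) sums (z * deriv (\<lambda>z. \<Sum>j. c j * z ^ j) z)"
    using sums_Suc_iff[of "\<lambda>j. of_nat j * c j * z ^ j"] by simp
  moreover have "(\<lambda>j. v * (c j * z ^ j)) sums (v * (\<Sum>j. c j * z ^ j))"
    using assms by (intro sums_mult summable_sums) auto
  ultimately show ?thesis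
    using sums_add by (fastforce simp: algebra_simps)
qed

lemma lerch_term_lower:
  fixes z s v :: complex
  assumes "v \<notin> \<int>\<^sub>\<le>\<^sub>0"
  shows "z ^ j / (of_nat j + v) powr s = (of_nat j + v) * (1 / (of_nat j + v) powr (s + 1)) * z ^ j"
  using plus_of_nat_nonzero[OF assms, of j] by (simp add: powr_add)

text \<open>For \<open>Re s > 1\<close> the coefficients are summable by themselves; every other exponent is reached
  by finitely many applications of the operator \<open>v + z d/dz\<close>, which preserve convergence in the disc.\<close>

lemma lerch_term_summable_disc:
  fixes z s v :: complex
  assumes "v \<notin> \<int>\<^sub>\<le>\<^sub>0" "norm z < 1"
  shows "summable (\<lambda>j. norm (z ^ j / (of_nat j + v) powr s))"
proof -
  have *: "summable (\<lambda>j. z ^ j / (of_nat j + v) powr s)" 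
    if "Re s + real n > 1" "norm z < 1" for n s z
    using that
  proof (induction n arbitrary: s z)
    case 0
    then show ?case using lerch_term_summable[of z s v] summable_norm_cancel by fastforce
  next
    case (Suc n)
    have "summable (\<lambda>j. 1 / (of_nat j + v) powr (s + 1) * z ^ j)" if "norm z < 1" for z
      using Suc.IH[of "s + 1" z] Suc.prems that by simp
    from euler_operator_power_series[OF this Suc.prems(2), of v] show ?case
      unfolding lerch_term_lower[OF assms(1)] by (simp add: sums_iff)
  qed
  obtain n :: nat where n: "real n > 1 - Re s" using reals_Archimedean2 by blast
  obtain r where r: "norm z < r" "r < 1" using assms dense by blast
  have "summable (\<lambda>j. 1 / (of_nat j + v) powr s * of_real r ^ j)"
    using *[of s n "of_real r"] n r order_le_less_trans[OF norm_ge_zero r(1)] by simp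
  from powser_insidea[OF this, of z] r show ?thesis
    by simp
qed

lemma lerch_term_summable_closed_disc:
  fixes z s v :: complex
  assumes "v \<notin> \<int>\<^sub>\<le>\<^sub>0" "norm z < 1 \<or> norm z = 1 \<and> Re s > 1"
  shows "summable (\<lambda>j. z ^ j / (of_nat j + v) powr s)"
  using assms lerch_term_summable[of z s v] lerch_term_summable_disc[of v z s]
  by (auto intro: summable_norm_cancel)

lemma plus_of_nat_notin_nonpos_Ints:
  fixes v :: complex
  assumes "v \<notin> \<int>\<^sub>\<le>\<^sub>0" shows "v + of_nat K \<notin> \<int>\<^sub>\<le>\<^sub>0"
proof
  assume "v + of_nat K \<in> \<int>\<^sub>\<le>\<^sub>0"
  then obtain n where "v + of_nat K = - of_nat n"
    by (elim nonpos_Ints_cases')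
  then have "v + of_nat K + of_nat n = 0" by simp
  then have "of_nat (K + n) + v = 0" by (simp add: add_ac)
  then show False using plus_of_nat_nonzero[OF assms] by blast
qed

text \<open>Splitting off initial terms moves the parameter to the right. It reduces all convergence
  and continuation questions to parameters with \<open>Re v \<ge> 1\<close>, where no \<open>j + v\<close> comes near the
  branch cut of the power and \<open>norm (j + v) \<ge> j + 1\<close>.\<close>

lemma lerch_series_shift:
  assumes "v \<notin> \<int>\<^sub>\<le>\<^sub>0" "norm z < 1 \<or> norm z = 1 \<and> Re s > 1"
  shows "lerch_series z s v =
           (\<Sum>j<K. z ^ j / (of_nat j + v) powr s) + z ^ K * lerch_series z s (v + of_nat K)"
proof -
  have v: "v + of_nat K \<notin> \<int>\<^sub>\<le>\<^sub>0"
    by (rule plus_of_nat_notin_nonpos_Ints[OF assms(1)])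
  have "lerch_series z s v = (\<Sum>j. z ^ (j + K) / (of_nat (j + K) + v) powr s)
          + (\<Sum>j<K. z ^ j / (of_nat j + v) powr s)"
    unfolding lerch_series_def by (rule suminf_split_initial_segment[OF lerch_term_summable_closed_disc[OF assms]])
  also have "(\<Sum>j. z ^ (j + K) / (of_nat (j + K) + v) powr s) =
             (\<Sum>j. z ^ K * (z ^ j / (of_nat j + (v + of_nat K)) powr s))"
    by (simp add: power_add algebra_simps)
  also have "\<dots> = z ^ K * lerch_series z s (v + of_nat K)"
    unfolding lerch_series_def using lerch_term_summable_closed_disc[OF v assms(2)]
    by (rule suminf_mult)
  finally show ?thesis by simp
qed

section \<open>Taylor remainders of complex powers\<close>

text \<open>The error of the Taylor polynomial of degree \<open>n\<close> of \<open>y \<mapsto> y powr (-s)\<close> about \<open>x\<close>, evaluated at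
  \<open>x + 1\<close>: the derivatives of the power divided by factorials are the generalised binomial
  coefficients \<open>- s gchoose i\<close>.\<close>

definition powr_taylor_rem :: "nat \<Rightarrow> complex \<Rightarrow> complex \<Rightarrow> complex" where
  "powr_taylor_rem n s x =
     (x + 1) powr (-s) - (\<Sum>i\<le>n. (- s gchoose i) * x powr (- s - of_nat i))"

text \<open>Each derivative of \<open>y powr (-s)\<close> gains one power of decay, so the remainder is smaller than
  the function by \<open>n + 1\<close> powers of \<open>x\<close>. This gain is what makes the remainder series below converge
  in a half-plane that extends \<open>n + 1\<close> units further to the left.\<close>

lemma norm_powr_taylor_rem_le:
  assumes x: "Re x \<ge> 1" and s: "\<sigma> \<le> Re s" "\<bar>Im s\<bar> \<le> B" and n: "\<sigma> + real n + 1 \<ge> 0"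
  shows "norm (powr_taylor_rem n s x) \<le>
           norm (- s gchoose Suc n) * (real (Suc n) * exp (pi * B)) * norm x powr (- (\<sigma> + real n + 1))"
proof -
  define f where "f = (\<lambda>i y. fact i * (- s gchoose i) * y powr (- s - of_nat i))"
  define b where "b = exp (pi * B) * norm x powr (- (\<sigma> + real n + 1))"
  let ?S = "closed_segment x (x + 1)"
  have seg: "Re y \<ge> 1 \<and> norm y \<ge> norm x" if y: "y \<in> ?S" for y
  proof -
    have "\<exists>t::real. 0 \<le> t \<and> y = x + of_real t"
    proof -
      obtain t where "0 \<le> t" "y = (1 - t) *\<^sub>R x + t *\<^sub>R (x + 1)"
        using y by (auto simp: closed_segment_def)
      then have "0 \<le> t \<and> y = x + of_real t"
        by (simp add: scaleR_conv_of_real algebra_simps)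
      then show ?thesis by blast
    qed
    then obtain t :: real where t: "0 \<le> t" "y = x + of_real t" by blast
    have "(Re x)\<^sup>2 \<le> (Re x + t)\<^sup>2" using t x by (intro power_mono) auto
    then show ?thesis using x t by (auto simp: cmod_def)
  qed
  have *: "norm (f 0 (x + 1) - (\<Sum>i\<le>n. f i x * (x + 1 - x) ^ i / fact i))
        \<le> (fact (Suc n) * norm (- s gchoose Suc n) * b) * norm (x + 1 - x) ^ Suc n / fact n"
  proof (rule complex_Taylor[of ?S])
    fix i y assume y: "y \<in> ?S"
    have rec: "(- s gchoose i) * (- s - of_nat i) = of_nat (Suc i) * (- s gchoose Suc i)"
      using gbinomial_mult_1[of "-s" i] by (simp add: algebra_simps)
    have "y \<notin> \<real>\<^sub>\<le>\<^sub>0" using seg[OF y] by (auto simp: complex_nonpos_Reals_iff)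
    then have "((\<lambda>y. fact i * (- s gchoose i) * y powr (- s - of_nat i)) has_field_derivative
               fact i * (- s gchoose i) * ((- s - of_nat i) * y powr (- s - of_nat i - 1))) (at y within ?S)"
      by (intro DERIV_cmult has_field_derivative_powr[THEN DERIV_subset]) auto
    also have "fact i * (- s gchoose i) * ((- s - of_nat i) * y powr (- s - of_nat i - 1)) =
               fact i * ((- s gchoose i) * (- s - of_nat i)) * y powr (- s - of_nat (Suc i))"
      by (simp add: algebra_simps)
    also have "\<dots> = f (Suc i) y" unfolding rec f_def by (simp add: algebra_simps)
    finally show "(f i has_field_derivative f (Suc i) y) (at y within ?S)"
      by (simp add: f_def)
  next
    fix y assume y: "y \<in> ?S"
    have "norm (y powr (- (s + of_nat (Suc n)))) \<le> exp (pi * B) * norm y powr (- (\<sigma> + real n + 1))"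
      using s seg[OF y] complex_Re_le_cmod[of y] by (intro norm_powr_minus_le) auto
    also have "\<dots> \<le> b"
      unfolding b_def using seg[OF y] n x complex_Re_le_cmod[of x]
      by (intro mult_left_mono powr_mono2') auto
    finally have le: "norm (y powr (- (s + of_nat (Suc n)))) \<le> b" .
    have "norm (f (Suc n) y) =
        fact (Suc n) * norm (- s gchoose Suc n) * norm (y powr (- (s + of_nat (Suc n))))"
      by (simp only: f_def norm_mult norm_fact minus_add_distrib diff_conv_add_uminus)
    also have "\<dots> \<le> fact (Suc n) * norm (- s gchoose Suc n) * b"
      by (rule mult_left_mono[OF le]) simp
    finally show "norm (f (Suc n) y) \<le> fact (Suc n) * norm (- s gchoose Suc n) * b" .
  qed (use convex_closed_segment in auto)
  have "f 0 (x + 1) - (\<Sum>i\<le>n. f i x * (x + 1 - x) ^ i / fact i) = powr_taylor_rem n s x"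
    by (simp add: f_def powr_taylor_rem_def)
  moreover have "fact (Suc n) * norm (- s gchoose Suc n) * b * norm (x + 1 - x) ^ Suc n / fact n =
      norm (- s gchoose Suc n) * (real (Suc n) * exp (pi * B)) * norm x powr (- (\<sigma> + real n + 1))"
    by (simp add: b_def fact_Suc)
  ultimately show ?thesis using * by metis
qed

lemma gbinomial_holomorphic [holomorphic_intros]:
  assumes "f holomorphic_on A"
  shows "(\<lambda>s. f s gchoose k) holomorphic_on A"
  unfolding gbinomial_prod_rev using assms by (intro holomorphic_intros) auto

lemma powr_taylor_rem_majorant:
  assumes v: "Re v \<ge> 1" and K: "compact K" "K \<subseteq> {s. Re s > - real n}"
  shows "\<exists>M. summable M \<and> (\<forall>j. \<forall>s\<in>K. norm (powr_taylor_rem n s (of_nat j + v)) \<le> M j)"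
proof (cases "K = {}")
  case False
  have "\<exists>s\<in>K. \<forall>t\<in>K. Re s \<le> Re t"
    by (intro continuous_attains_inf K(1) False continuous_intros)
  then obtain s0 where s0: "s0 \<in> K" "\<And>s. s \<in> K \<Longrightarrow> Re s0 \<le> Re s" by blast
  obtain B where B: "\<And>s. s \<in> K \<Longrightarrow> norm s \<le> B"
    using compact_imp_bounded[OF K(1)] by (auto simp: bounded_iff)
  have "(\<lambda>s. - s gchoose Suc n) holomorphic_on K"
    by (intro holomorphic_intros)
  then have "compact ((\<lambda>s. - s gchoose Suc n) ` K)"
    using K(1) by (intro compact_continuous_image holomorphic_on_imp_continuous_on)
  then obtain C where C: "\<And>s. s \<in> K \<Longrightarrow> norm (- s gchoose Suc n) \<le> C"
    using compact_imp_bounded by (fastforce simp: bounded_iff)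
  have C0: "C \<ge> 0" using C[OF s0(1)] norm_ge_zero order_trans by blast
  have pos: "Re s0 + real n > 0" using s0(1) K(2) by auto
  define \<sigma> where "\<sigma> = Re s0 + real n + 1"
  define M where "M = (\<lambda>j::nat. C * (real (Suc n) * exp (pi * B)) * (real j + 1) powr (-\<sigma>))"
  have "norm (powr_taylor_rem n s (of_nat j + v)) \<le> M j" if "s \<in> K" for s j
  proof -
    let ?x = "of_nat j + v"
    have "norm (powr_taylor_rem n s ?x) \<le>
        norm (- s gchoose Suc n) * (real (Suc n) * exp (pi * B)) * norm ?x powr (-\<sigma>)"
      unfolding \<sigma>_def using v s0(2)[OF that] pos abs_Im_le_cmod[of s] B[OF that]
      by (intro norm_powr_taylor_rem_le) auto
    also have "\<dots> \<le> M j"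
      unfolding M_def using C[OF that] C0 norm_plus_of_nat_ge[OF v, of j] pos
      by (intro mult_mono powr_mono2') (auto simp: \<sigma>_def)
    finally show ?thesis .
  qed
  moreover have "summable M"
    unfolding M_def by (intro summable_mult summable_Suc_powr) (use pos in \<open>auto simp: \<sigma>_def\<close>)
  ultimately show ?thesis by blast
qed (auto intro: exI[of _ "\<lambda>_. 0"])

section \<open>Recursions that lower the exponent\<close>

definition lerch_taylor_rem :: "nat \<Rightarrow> complex \<Rightarrow> complex \<Rightarrow> complex \<Rightarrow> complex" where
  "lerch_taylor_rem n z s v = (\<Sum>j. z ^ j * powr_taylor_rem n s (of_nat j + v))"

lemma powr_plus_of_nat_holomorphic:
  fixes v :: complex
  assumes "v \<notin> \<int>\<^sub>\<le>\<^sub>0" "f holomorphic_on A"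
  shows "(\<lambda>s. (of_nat j + v) powr f s) holomorphic_on A"
  using plus_of_nat_nonzero[OF assms(1), of j] assms(2)
  by (simp add: powr_def) (intro holomorphic_intros)

lemma powr_taylor_rem_holomorphic:
  fixes x :: complex
  assumes "x \<noteq> 0" "x + 1 \<noteq> 0"
  shows "(\<lambda>s. powr_taylor_rem n s x) holomorphic_on A"
  using assms unfolding powr_taylor_rem_def powr_def 
  by simp (intro holomorphic_intros)

lemma Re_ge_1_nonpos_Ints: "Re v \<ge> 1 \<Longrightarrow> v \<notin> \<int>\<^sub>\<le>\<^sub>0"
  by (auto elim!: nonpos_Ints_cases')

lemma lerch_taylor_rem_holomorphic:
  assumes v: "Re v \<ge> 1" and "norm z \<le> 1"
  shows "(\<lambda>s. lerch_taylor_rem n z s v) holomorphic_on {s. Re s > - real n}"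
  unfolding lerch_taylor_rem_def
proof (rule holomorphic_on_suminf)
  show "open {s. Re s > - real n}" by (rule open_halfspace_Re_gt)
  show "(\<lambda>s. z ^ j * powr_taylor_rem n s (of_nat j + v)) holomorphic_on {s. Re s > - real n}" for j
  proof (intro holomorphic_intros powr_taylor_rem_holomorphic)
    show "of_nat j + v \<noteq> 0" "of_nat j + v + 1 \<noteq> 0"
      using v by (auto simp: complex_eq_iff)
  qed
  fix K assume K: "compact K" "K \<subseteq> {s. Re s > - real n}"
  obtain M where M: "summable M" "\<forall>j. \<forall>s\<in>K. norm (powr_taylor_rem n s (of_nat j + v)) \<le> M j"
    using powr_taylor_rem_majorant[OF v K] by metis
  have "norm (z ^ j * powr_taylor_rem n s (of_nat j + v)) \<le> M j" if "s \<in> K" for j s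
  proof -
    have "norm (z ^ j * powr_taylor_rem n s (of_nat j + v)) \<le>
          1 * norm (powr_taylor_rem n s (of_nat j + v))"
      unfolding norm_mult norm_power using assms by (intro mult_right_mono power_le_one) auto
    also have "\<dots> \<le> M j" using M(2) that by simp
    finally show ?thesis .
  qed
  then show "\<exists>M. summable M \<and> (\<forall>j. \<forall>s\<in>K. norm (z ^ j * powr_taylor_rem n s (of_nat j + v)) \<le> M j)"
    using M(1) by blast
qed

lemma lerch_taylor_rem_continuous:
  assumes v: "Re v \<ge> 1" and s: "Re s > - real n"
  shows "continuous_on (cball 0 1) (\<lambda>z. lerch_taylor_rem n z s v)"
proof -
  obtain M where M: "summable M" "\<forall>j. norm (powr_taylor_rem n s (of_nat j + v)) \<le> M j"
    using powr_taylor_rem_majorant[OF v, of "{s}"] s by auto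
  show ?thesis unfolding lerch_taylor_rem_def
  proof (rule continuous_on_suminf[OF _ M(1)])
    fix j and z :: complex assume "z \<in> cball 0 1"
    then have "norm (z ^ j * powr_taylor_rem n s (of_nat j + v)) \<le>
          1 * norm (powr_taylor_rem n s (of_nat j + v))"
      unfolding norm_mult norm_power by (intro mult_right_mono power_le_one) auto
    also have "\<dots> \<le> M j" using M(2) by simp
    finally show "norm (z ^ j * powr_taylor_rem n s (of_nat j + v)) \<le> M j" .
  qed (intro continuous_intros)
qed

text \<open>Expanding every \<open>(j + v + 1) powr (-s)\<close> about \<open>j + v\<close> expresses the series at \<open>v + 1\<close> through
  series at \<open>v\<close> with exponents \<open>s, s + 1, \<dots>, s + n\<close>. Combined with the trivial shift relation
  between the parameters \<open>v\<close> and \<open>v + 1\<close> it gives the recursion that follows.\<close>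

lemma lerch_series_plus_one:
  assumes v: "Re v \<ge> 1" and zs: "norm z < 1 \<or> norm z = 1 \<and> Re s > 1"
  shows "lerch_series z s (v + 1) =
     (\<Sum>i\<le>n. (- s gchoose i) * lerch_series z (s + of_nat i) v) + lerch_taylor_rem n z s v"
proof -
  have v': "v \<notin> \<int>\<^sub>\<le>\<^sub>0" and v1: "v + 1 \<notin> \<int>\<^sub>\<le>\<^sub>0"
    using v Re_ge_1_nonpos_Ints by auto
  have a: "(\<lambda>j. z ^ j / (of_nat j + (v + 1)) powr s) sums lerch_series z s (v + 1)"
    unfolding lerch_series_def by (intro summable_sums lerch_term_summable_closed_disc v1 zs)
  have b: "(\<lambda>j. \<Sum>i\<le>n. (- s gchoose i) * (z ^ j / (of_nat j + v) powr (s + of_nat i))) sums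
             (\<Sum>i\<le>n. (- s gchoose i) * lerch_series z (s + of_nat i) v)"
    unfolding lerch_series_def
    using zs by (intro sums_sum sums_mult summable_sums lerch_term_summable_closed_disc v') auto
  have "(\<lambda>j. z ^ j * powr_taylor_rem n s (of_nat j + v)) sums (lerch_series z s (v + 1) -
           (\<Sum>i\<le>n. (- s gchoose i) * lerch_series z (s + of_nat i) v))"
    using sums_diff[OF a b]
    by (simp add: powr_taylor_rem_def powr_minus_divide powr_diff powr_add sum_distrib_left
        algebra_simps)
  then show ?thesis unfolding lerch_taylor_rem_def by (simp add: sums_iff)
qed

text \<open>The right-hand side involves only exponents \<open>s + i\<close> with \<open>i \<ge> 1\<close> and a remainder that is
  holomorphic for \<open>Re s > - n\<close>. Away from \<open>z = 1\<close> one can divide by \<open>1 - z\<close>, so a continuation to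
  a half-plane extends by one unit to the left.\<close>

lemma lerch_series_recursion:
  assumes v: "Re v \<ge> 1" and zs: "norm z < 1 \<or> norm z = 1 \<and> Re s > 1"
  shows "(1 - z) * lerch_series z s v = v powr (-s) +
     z * ((\<Sum>i=1..n. (- s gchoose i) * lerch_series z (s + of_nat i) v) + lerch_taylor_rem n z s v)"
proof -
  have "lerch_series z s v = v powr (-s) + z * lerch_series z s (v + 1)"
    using lerch_series_shift[OF Re_ge_1_nonpos_Ints[OF v] zs, of 1] by (simp add: powr_minus_divide)
  then have "(1 - z) * lerch_series z s v =
      v powr (-s) + z * (lerch_series z s (v + 1) - lerch_series z s v)"
    by (simp add: algebra_simps)
  moreover have "{..n} = insert 0 {1..n}" by auto
  then have "lerch_series z s (v + 1) - lerch_series z s v =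
      (\<Sum>i=1..n. (- s gchoose i) * lerch_series z (s + of_nat i) v) + lerch_taylor_rem n z s v"
    using lerch_series_plus_one[OF v zs, of n] by simp
  ultimately show ?thesis by simp
qed

text \<open>At \<open>z = 1\<close> the leading terms of the recursion cancel. What remains comes from the telescoping
  sum of \<open>(j + v) powr (-s) - (j + v + 1) powr (-s)\<close>; its first-order Taylor term is
  \<open>s (j + v) powr (-s-1)\<close>, and this is the source of the pole of the Hurwitz zeta function.\<close>

lemma hurwitz_series_recursion:
  assumes v: "Re v \<ge> 1" and s: "Re s > 0"
  shows "s * lerch_series 1 (s + 1) v = v powr (-s) +
     (\<Sum>i=2..Suc n. (- s gchoose i) * lerch_series 1 (s + of_nat i) v) + lerch_taylor_rem (Suc n) 1 s v"
proof -
  have v': "v \<notin> \<int>\<^sub>\<le>\<^sub>0" using v Re_ge_1_nonpos_Ints by auto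
  define h where "h = (\<lambda>j::nat. (of_nat j + v) powr (-s))"
  have "h \<longlonglongrightarrow> 0"
  proof (rule Lim_null_comparison)
    have "norm (h j) \<le> exp (pi * \<bar>Im s\<bar>) * (real j + 1) powr (-Re s)" for j
    proof -
      have j: "norm (of_nat j + v) \<ge> real j + 1" using v by (rule norm_plus_of_nat_ge)
      have "norm (h j) \<le> exp (pi * \<bar>Im s\<bar>) * norm (of_nat j + v) powr (-Re s)"
        unfolding h_def using j by (intro norm_powr_minus_le) auto
      also have "\<dots> \<le> exp (pi * \<bar>Im s\<bar>) * (real j + 1) powr (-Re s)"
        using j s by (intro mult_left_mono powr_mono2') auto
      finally show ?thesis .
    qed
    then show "\<forall>\<^sub>F j in sequentially. norm (h j) \<le> exp (pi * \<bar>Im s\<bar>) * (real j + 1) powr (-Re s)"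
      by simp
    have "(\<lambda>j. (real j + 1) powr (-Re s)) \<longlonglongrightarrow> 0"
      using s by real_asymp
    from tendsto_mult_right_zero[OF this]
    show "(\<lambda>j. exp (pi * \<bar>Im s\<bar>) * (real j + 1) powr (-Re s)) \<longlonglongrightarrow> 0" .
  qed
  then have a: "(\<lambda>j. h (Suc j) - h j) sums (0 - v powr (-s))"
    using telescope_sums[of h 0] by (simp add: h_def)
  have b: "(\<lambda>j. \<Sum>i=1..Suc n. (- s gchoose i) * (1 ^ j / (of_nat j + v) powr (s + of_nat i))) sums
             (\<Sum>i=1..Suc n. (- s gchoose i) * lerch_series 1 (s + of_nat i) v)"
    unfolding lerch_series_def
    using s by (intro sums_sum sums_mult summable_sums lerch_term_summable_closed_disc v') auto
  have split: "{..Suc n} = insert 0 {1..Suc n}" by auto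
  have pw: "x powr (- s - of_nat i) = 1 / x powr (s + of_nat i)" for x i
    using powr_minus_divide[of x "s + of_nat i"] by simp
  have eq: "h (Suc j) - h j -
      (\<Sum>i=1..Suc n. (- s gchoose i) * (1 ^ j / (of_nat j + v) powr (s + of_nat i))) =
      1 ^ j * powr_taylor_rem (Suc n) s (of_nat j + v)" for j
    unfolding powr_taylor_rem_def split pw h_def
    by (simp add: powr_minus_divide add_ac del: sum.cl_ivl_Suc)
  have "(\<lambda>j. 1 ^ j * powr_taylor_rem (Suc n) s (of_nat j + v)) sums (0 - v powr (-s) -
           (\<Sum>i=1..Suc n. (- s gchoose i) * lerch_series 1 (s + of_nat i) v))"
    using sums_diff[OF a b] unfolding eq .
  then have "lerch_taylor_rem (Suc n) 1 s v = 0 - v powr (-s) -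
           (\<Sum>i=1..Suc n. (- s gchoose i) * lerch_series 1 (s + of_nat i) v)"
    unfolding lerch_taylor_rem_def by (simp add: sums_iff)
  moreover have split': "{1..Suc n} = insert 1 {2..Suc n}" by auto
  have "(\<Sum>i=1..Suc n. (- s gchoose i) * lerch_series 1 (s + of_nat i) v) =
      - s * lerch_series 1 (s + 1) v + (\<Sum>i=2..Suc n. (- s gchoose i) * lerch_series 1 (s + of_nat i) v)"
    unfolding split' by (subst sum.insert) auto
  ultimately show ?thesis by simp
qed

section \<open>Continuation in the exponent, strip by strip\<close>

lemma lerch_term_majorant:
  assumes v: "Re v \<ge> 1" and K: "compact K" "K \<subseteq> {s. Re s > 1}"
  shows "\<exists>M. summable M \<and> (\<forall>j. \<forall>s\<in>K. \<forall>z\<in>cball 0 1. norm (z ^ j / (of_nat j + v) powr s) \<le> M j)"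
proof (cases "K = {}")
  case False
  have "\<exists>s\<in>K. \<forall>t\<in>K. Re s \<le> Re t"
    by (intro continuous_attains_inf K(1) False continuous_intros)
  then obtain s0 where s0: "s0 \<in> K" "\<And>s. s \<in> K \<Longrightarrow> Re s0 \<le> Re s" by blast
  obtain B where B: "\<And>s. s \<in> K \<Longrightarrow> norm s \<le> B"
    using compact_imp_bounded[OF K(1)] by (auto simp: bounded_iff)
  have s0_gt: "Re s0 > 1" using s0(1) K(2) by auto
  define M where "M = (\<lambda>j::nat. exp (pi * B) * (real j + 1) powr (- Re s0))"
  have "norm (z ^ j / (of_nat j + v) powr s) \<le> M j" if "s \<in> K" "z \<in> cball 0 1" for s z j
  proof -
    let ?x = "of_nat j + v"
    have x: "norm ?x \<ge> real j + 1" using v by (rule norm_plus_of_nat_ge)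
    have "norm (z ^ j / ?x powr s) = norm z ^ j * norm (?x powr (-s))"
      by (simp add: norm_divide norm_mult norm_power powr_minus_divide)
    also have "\<dots> \<le> 1 * (exp (pi * B) * norm ?x powr (-Re s0))"
      using x that s0(2)[OF that(1)] abs_Im_le_cmod[of s] B[OF that(1)]
      by (intro mult_mono norm_powr_minus_le power_le_one) auto
    also have "norm ?x powr (-Re s0) \<le> (real j + 1) powr (-Re s0)"
      using x s0_gt by (intro powr_mono2') auto
    finally show ?thesis by (simp add: M_def)
  qed
  moreover have "summable M"
    unfolding M_def by (intro summable_mult summable_Suc_powr s0_gt)
  ultimately show ?thesis by blast
qed (auto intro: exI[of _ "\<lambda>_. 0"])

lemma lerch_series_holomorphic_exponent:
  assumes v: "Re v \<ge> 1" and z: "norm z \<le> 1"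
  shows "(\<lambda>s. lerch_series z s v) holomorphic_on {s. Re s > 1}"
  unfolding lerch_series_def
proof (rule holomorphic_on_suminf)
  show "open {s. Re s > 1}" by (rule open_halfspace_Re_gt)
  show "(\<lambda>s. z ^ j / (of_nat j + v) powr s) holomorphic_on {s. Re s > 1}" for j
    using plus_of_nat_nonzero[OF Re_ge_1_nonpos_Ints[OF v], of j]
    by (intro holomorphic_intros powr_plus_of_nat_holomorphic Re_ge_1_nonpos_Ints[OF v]) auto
  fix K assume K: "compact K" "K \<subseteq> {s. Re s > 1}"
  obtain M where M: "summable M"
    "\<forall>j. \<forall>s\<in>K. \<forall>z\<in>cball 0 1. norm (z ^ j / (of_nat j + v) powr s) \<le> M j"
    using lerch_term_majorant[OF v K] by metis
  show "\<exists>M. summable M \<and> (\<forall>j. \<forall>s\<in>K. norm (z ^ j / (of_nat j + v) powr s) \<le> M j)"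
    using M z by (intro exI[of _ M]) auto
qed

lemma lerch_series_continuous_closed_disc:
  assumes v: "Re v \<ge> 1" and s: "Re s > 1"
  shows "continuous_on (cball 0 1) (\<lambda>z. lerch_series z s v)"
proof -
  obtain M where M: "summable M"
    "\<forall>j. \<forall>z\<in>cball 0 1. norm (z ^ j / (of_nat j + v) powr s) \<le> M j"
    using lerch_term_majorant[OF v, of "{s}"] s by auto
  show ?thesis unfolding lerch_series_def
    using plus_of_nat_nonzero[OF Re_ge_1_nonpos_Ints[OF v]] M(2)
    by (intro continuous_on_suminf[OF _ M(1)] continuous_intros) auto
qed

text \<open>Induction on the half-plane, one strip at a time, by \<open>lerch_series_recursion\<close>. Besides being holomorphic in \<open>s\<close>, the continuation
  stays continuous in \<open>z\<close> up to the unit circle and equals the series inside the disc for every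
  exponent in the half-plane. These two facts later identify it, on the circle, with the continuation in
  \<open>z\<close>.\<close>

lemma lerch_closed_disc_strip:
  assumes v: "Re v \<ge> 1"
  shows "\<exists>f. (\<forall>z\<in>cball 0 1 - {1}. f z holomorphic_on {s. Re s > 1 - real N}) \<and>
    (\<forall>z\<in>cball 0 1 - {1}. \<forall>s. norm z < 1 \<and> Re s > 1 - real N \<or> norm z = 1 \<and> Re s > 1 \<longrightarrow>
        f z s = lerch_series z s v) \<and>
    (\<forall>s. Re s > 1 - real N \<longrightarrow> continuous_on (cball 0 1 - {1}) (\<lambda>z. f z s))"
proof (induction N)
  case 0
  have "continuous_on (cball 0 1 - {1}) (\<lambda>z. lerch_series z s v)" if "Re s > 1" for s
    by (rule continuous_on_subset[OF lerch_series_continuous_closed_disc[OF v that]]) auto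
  then show ?case
    using lerch_series_holomorphic_exponent[OF v]
    by (intro exI[of _ "\<lambda>z s. lerch_series z s v"]) auto
next
  case (Suc N)
  let ?D = "cball 0 1 - {1 :: complex}"
  obtain f where hol: "\<And>z. z \<in> ?D \<Longrightarrow> f z holomorphic_on {s. Re s > 1 - real N}"
    and eq: "\<And>z s. z \<in> ?D \<Longrightarrow> norm z < 1 \<and> Re s > 1 - real N \<or> norm z = 1 \<and> Re s > 1 \<Longrightarrow>
        f z s = lerch_series z s v"
    and cont: "\<And>s. Re s > 1 - real N \<Longrightarrow> continuous_on ?D (\<lambda>z. f z s)"
    using Suc.IH by metis
  \<comment> \<open>The recursion solved for the series; \<open>N\<close> Taylor terms suffice to gain the next strip.\<close>
  define g where "g = (\<lambda>z s. (v powr (-s) + z * ((\<Sum>i=1..N. (- s gchoose i) * f z (s + of_nat i)) +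
      lerch_taylor_rem N z s v)) / (1 - z))"
  have "g z holomorphic_on {s. Re s > 1 - real (Suc N)}" if z: "z \<in> ?D" for z
  proof -
    have 1: "(\<lambda>s. f z (s + of_nat i)) holomorphic_on {s. Re s > 1 - real (Suc N)}" if "i \<ge> 1" for i
    proof -
      have "(f z \<circ> (\<lambda>s. s + of_nat i)) holomorphic_on {s. Re s > 1 - real (Suc N)}"
        using that by (intro holomorphic_on_compose_gen[OF _ hol[OF z]] holomorphic_intros) auto
      then show ?thesis by (simp add: o_def)
    qed
    have 2: "(\<lambda>s. lerch_taylor_rem N z s v) holomorphic_on {s. Re s > 1 - real (Suc N)}"
      using z by (intro holomorphic_on_subset[OF lerch_taylor_rem_holomorphic[OF v]]) auto
    have 3: "(\<lambda>s. v powr (-s)) holomorphic_on {s. Re s > 1 - real (Suc N)}"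
      using powr_plus_of_nat_holomorphic[OF Re_ge_1_nonpos_Ints[OF v], of uminus _ 0]
      by (simp add: holomorphic_on_minus)
    show ?thesis unfolding g_def using z
      by (intro holomorphic_intros 1 2 3) auto
  qed
  moreover have "g z s = lerch_series z s v"
    if z: "z \<in> ?D" and zs: "norm z < 1 \<and> Re s > 1 - real (Suc N) \<or> norm z = 1 \<and> Re s > 1" for z s
  proof -
    have "f z (s + of_nat i) = lerch_series z (s + of_nat i) v" if "i \<in> {1..N}" for i
      using z zs that by (intro eq) auto
    then have "g z s = (1 - z) * lerch_series z s v / (1 - z)"
      unfolding g_def using zs by (subst lerch_series_recursion[OF v, of z s N]) auto
    then show ?thesis using z by simp
  qed
  moreover have "continuous_on ?D (\<lambda>z. g z s)" if "Re s > 1 - real (Suc N)" for s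
  proof -
    have 1: "continuous_on ?D (\<lambda>z. f z (s + of_nat i))" if "i \<in> {1..N}" for i
      using \<open>Re s > 1 - real (Suc N)\<close> that by (intro cont) auto
    have 2: "continuous_on ?D (\<lambda>z. lerch_taylor_rem N z s v)"
      using that by (intro continuous_on_subset[OF lerch_taylor_rem_continuous[OF v]]) auto
    show ?thesis unfolding g_def by (intro continuous_intros 1 2) auto
  qed
  ultimately show ?case by (intro exI[of _ g]) blast
qed

text \<open>The recursion continues \<open>(s - 1) \<zeta>(s, v)\<close> rather than \<open>\<zeta>(s, v)\<close>: the coefficient of
  \<open>\<zeta>(s + i, v)\<close> contains the factor \<open>s + i - 1\<close>, which cancels the pole of that term.\<close>

lemma hurwitz_strip:
  assumes v: "Re v \<ge> 1"
  shows "\<exists>f. f holomorphic_on {s. Re s > 1 - real N} \<and>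
    (\<forall>s. Re s > 1 \<longrightarrow> f s = (s - 1) * lerch_series 1 s v)"
proof (induction N)
  case 0
  show ?case
    by (rule exI[of _ "\<lambda>s. (s - 1) * lerch_series 1 s v"])
       (auto intro!: holomorphic_intros lerch_series_holomorphic_exponent[OF v])
next
  case (Suc N)
  obtain f where hol: "f holomorphic_on {s. Re s > 1 - real N}"
    and eq: "\<And>s. Re s > 1 \<Longrightarrow> f s = (s - 1) * lerch_series 1 s v"
    using Suc.IH by metis
  \<comment> \<open>The recursion at \<open>s - 1\<close>, with \<open>f\<close> in place of \<open>(s - 1) \<zeta>(s, v)\<close>.\<close>
  define g where "g = (\<lambda>s. v powr (1 - s)
      - (\<Sum>i=1..N. (1 - s gchoose i) / of_nat (Suc i) * f (s + of_nat i))
      + lerch_taylor_rem (Suc N) 1 (s - 1) v)"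
  have 1: "(\<lambda>s. f (s + of_nat i)) holomorphic_on {s. Re s > 1 - real (Suc N)}" if "i \<ge> 1" for i
  proof -
    have "(f \<circ> (\<lambda>s. s + of_nat i)) holomorphic_on {s. Re s > 1 - real (Suc N)}"
      using that by (intro holomorphic_on_compose_gen[OF _ hol] holomorphic_intros) auto
    then show ?thesis by (simp add: o_def)
  qed
  have 2: "(\<lambda>s. lerch_taylor_rem (Suc N) 1 (s - 1) v) holomorphic_on {s. Re s > 1 - real (Suc N)}"
  proof -
    have "((\<lambda>s. lerch_taylor_rem (Suc N) 1 s v) \<circ> (\<lambda>s. s - 1)) holomorphic_on
        {s. Re s > 1 - real (Suc N)}"
      by (intro holomorphic_on_compose_gen[OF _ lerch_taylor_rem_holomorphic[OF v]] holomorphic_intros) auto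
    then show ?thesis by (simp add: o_def)
  qed
  have 3: "(\<lambda>s. v powr (1 - s)) holomorphic_on {s. Re s > 1 - real (Suc N)}"
    using powr_plus_of_nat_holomorphic[OF Re_ge_1_nonpos_Ints[OF v], of "\<lambda>s. 1 - s" _ 0]
    by (simp add: holomorphic_on_diff)
  have "g holomorphic_on {s. Re s > 1 - real (Suc N)}"
    unfolding g_def by (intro holomorphic_intros 1 2 3) auto
  moreover have "g s = (s - 1) * lerch_series 1 s v" if s: "Re s > 1" for s
  proof -
    have "(1 - s gchoose Suc i) * lerch_series 1 (s - 1 + of_nat (Suc i)) v =
          - ((1 - s gchoose i) / of_nat (Suc i) * f (s + of_nat i))" for i
    proof -
      have "of_nat (Suc i) * (1 - s gchoose Suc i) = (1 - s - of_nat i) * (1 - s gchoose i)"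
        using gbinomial_mult_1[of "1 - s" i] by (simp add: algebra_simps)
      then have "(1 - s gchoose Suc i) = - ((1 - s gchoose i) / of_nat (Suc i) * (s + of_nat i - 1))"
        by (simp add: field_simps del: of_nat_Suc)
      moreover have "f (s + of_nat i) = (s + of_nat i - 1) * lerch_series 1 (s + of_nat i) v"
        using s by (intro eq) auto
      moreover have "s - 1 + of_nat (Suc i) = s + of_nat i" by simp
      ultimately show ?thesis by (simp only: mult_minus_left mult.assoc)
    qed
    then have "(\<Sum>i=2..Suc N. (1 - s gchoose i) * lerch_series 1 (s - 1 + of_nat i) v) =
        - (\<Sum>i=1..N. (1 - s gchoose i) / of_nat (Suc i) * f (s + of_nat i))"
      unfolding sum_negf[symmetric] numeral_2_eq_2 One_nat_def
      by (subst sum.shift_bounds_cl_Suc_ivl) (rule sum.cong, auto)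
    then show ?thesis
      using hurwitz_series_recursion[OF v, of "s - 1" N] s by (simp add: g_def del: of_nat_Suc)
  qed
  ultimately show ?case by blast
qed

lemma holomorphic_from_half_planes:
  assumes "\<And>N::nat. \<exists>f. f holomorphic_on {s. Re s > 1 - real N} \<and> (\<forall>s. Re s > 1 \<longrightarrow> f s = g s)"
  shows "\<exists>f. f holomorphic_on UNIV \<and> (\<forall>s. Re s > 1 \<longrightarrow> f s = g s)"
proof -
  obtain F where hol: "\<And>N::nat. F N holomorphic_on {s. Re s > 1 - real N}"
    and eq: "\<And>N s. Re s > 1 \<Longrightarrow> F N s = g s"
    using assms by metis
  have agree: "F M s = F N s" if "M \<le> N" "Re s > 1 - real M" for M N s
  proof (rule analytic_continuation_open[of "{s. Re s > 1}" "{s. Re s > 1 - real M}" "F M" "F N" s])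
    show "F N holomorphic_on {s. Re s > 1 - real M}"
      by (rule holomorphic_on_subset[OF hol]) (use that in auto)
    have "(2::complex) \<in> {s. Re s > 1}" by simp
    then show "{s. Re s > 1} \<noteq> {}" by blast
    show "connected {s. Re s > 1 - real M}"
      by (intro convex_connected convex_halfspace_Re_gt)
    show "F M s = F N s" if "s \<in> {s. Re s > 1}" for s
      using eq that by simp
    show "{s. Re s > 1} \<subseteq> {s. Re s > 1 - real M}" by auto
    show "s \<in> {s. Re s > 1 - real M}" using that(2) by simp
  qed (rule open_halfspace_Re_gt hol)+
  have agree': "F M s = F N s" if "Re s > 1 - real M" "Re s > 1 - real N" for M N s
    using agree[of M N s] agree[of N M s, symmetric] that nat_le_linear[of M N] by blast
  \<comment> \<open>All half-planes that contain \<open>s\<close> give the same value; this index selects one of them.\<close>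
  define f where "f = (\<lambda>s. F (nat \<lceil>2 - Re s\<rceil>) s)"
  have f: "f s = F N s" if "Re s > 1 - real N" for N s
    unfolding f_def using that real_nat_ceiling_ge[of "2 - Re s"] by (intro agree') auto
  have "f holomorphic_on (\<Union>N. {s. Re s > 1 - real N})"
  proof (rule holomorphic_on_UN_open)
    show "f holomorphic_on {s. Re s > 1 - real N}" for N
      by (rule holomorphic_transform[OF hol]) (metis f mem_Collect_eq)
  qed (rule open_halfspace_Re_gt)
  moreover have "(\<Union>N. {s. Re s > 1 - real N}) = (UNIV :: complex set)"
  proof -
    have "\<exists>N. Re s > 1 - real N" for s
      using reals_Archimedean2[of "1 - Re s"] by (auto simp: algebra_simps)
    then show ?thesis by auto
  qed
  moreover have "f s = g s" if "Re s > 1" for s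
    using f[of 0 s] eq[of s 0] that by simp
  ultimately show ?thesis by auto
qed

lemma shift_to_Re_ge:
  fixes v :: complex
  obtains K :: nat where "Re (v + of_nat K) \<ge> b"
proof -
  obtain K :: nat where "real K \<ge> b - Re v" using real_nat_ceiling_ge by blast
  then show ?thesis using that[of K] by simp
qed

text \<open>Dividing the entire function obtained from the strips by \<open>s - 1\<close>, after moving the parameter into
  \<open>Re v \<ge> 1\<close>.\<close>

theorem hurwitz_continuation:
  assumes v: "v \<notin> \<int>\<^sub>\<le>\<^sub>0"
  shows "\<exists>f. f holomorphic_on - {1} \<and> (\<forall>s. Re s > 1 \<longrightarrow> f s = lerch_series 1 s v)"
proof -
  obtain K where K: "Re (v + of_nat K) \<ge> 1" using shift_to_Re_ge .
  obtain f where f: "f holomorphic_on UNIV"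
    "\<And>s. Re s > 1 \<Longrightarrow> f s = (s - 1) * lerch_series 1 s (v + of_nat K)"
    using holomorphic_from_half_planes[OF hurwitz_strip[OF K]] by metis
  define g where "g = (\<lambda>s. (\<Sum>j<K. 1 / (of_nat j + v) powr s) + f s / (s - 1))"
  have "g holomorphic_on - {1}"
    unfolding g_def using plus_of_nat_nonzero[OF v]
    by (intro holomorphic_intros powr_plus_of_nat_holomorphic[OF v] holomorphic_on_subset[OF f(1)]) auto
  moreover have "g s = lerch_series 1 s v" if "Re s > 1" for s
  proof -
    have "s \<noteq> 1" using that by auto
    then show ?thesis
      using lerch_series_shift[OF v, of 1 s K] that f(2)[OF that] by (simp add: g_def)
  qed
  ultimately show ?thesis by blast
qed

theorem lerch_closed_disc_continuation:
  assumes v: "v \<notin> \<int>\<^sub>\<le>\<^sub>0"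
  shows "\<exists>f. (\<forall>z\<in>cball 0 1 - {1}. f z holomorphic_on {s. Re s > 1 - real N}) \<and>
    (\<forall>z\<in>cball 0 1 - {1}. \<forall>s. norm z < 1 \<and> Re s > 1 - real N \<or> norm z = 1 \<and> Re s > 1 \<longrightarrow>
        f z s = lerch_series z s v) \<and>
    (\<forall>s. Re s > 1 - real N \<longrightarrow> continuous_on (cball 0 1 - {1}) (\<lambda>z. f z s))"
proof -
  let ?D = "cball 0 1 - {1 :: complex}"
  obtain K where K: "Re (v + of_nat K) \<ge> 1" using shift_to_Re_ge .
  obtain f where hol: "\<And>z. z \<in> ?D \<Longrightarrow> f z holomorphic_on {s. Re s > 1 - real N}"
    and eq: "\<And>z s. z \<in> ?D \<Longrightarrow> norm z < 1 \<and> Re s > 1 - real N \<or> norm z = 1 \<and> Re s > 1 \<Longrightarrow>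
        f z s = lerch_series z s (v + of_nat K)"
    and cont: "\<And>s. Re s > 1 - real N \<Longrightarrow> continuous_on ?D (\<lambda>z. f z s)"
    using lerch_closed_disc_strip[OF K, of N] by metis
  define g where "g = (\<lambda>z s. (\<Sum>j<K. z ^ j / (of_nat j + v) powr s) + z ^ K * f z s)"
  have "g z holomorphic_on {s. Re s > 1 - real N}" if "z \<in> ?D" for z
    unfolding g_def using plus_of_nat_nonzero[OF v]
    by (intro holomorphic_intros powr_plus_of_nat_holomorphic[OF v] hol that) auto
  moreover have "g z s = lerch_series z s v"
    if "z \<in> ?D" "norm z < 1 \<and> Re s > 1 - real N \<or> norm z = 1 \<and> Re s > 1" for z s
    unfolding g_def eq[OF that] using that(2) by (subst lerch_series_shift[OF v, of z s K]) auto
  moreover have "continuous_on ?D (\<lambda>z. g z s)" if "Re s > 1 - real N" for s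
    unfolding g_def using plus_of_nat_nonzero[OF v]
    by (intro continuous_intros cont that) auto
  ultimately show ?thesis by (intro exI[of _ g]) blast
qed

section \<open>Holomorphic integrals over the half-line\<close>

lemma holomorphic_on_locally:
  assumes "\<And>w. w \<in> U \<Longrightarrow> \<exists>V. open V \<and> w \<in> V \<and> f holomorphic_on V"
  shows "f holomorphic_on U"
  unfolding holomorphic_on_def
proof
  fix w assume "w \<in> U"
  then obtain V where "open V" "w \<in> V" "f holomorphic_on V" using assms by blast
  then have "f field_differentiable at w" using holomorphic_on_imp_differentiable_at by blast
  then show "f field_differentiable at w within U" by (rule field_differentiable_at_within)
qed

lemma integrable_on_halfline_dominated:
  fixes h :: "real \<Rightarrow> complex"
  assumes "continuous_on {0..} h" "\<phi> integrable_on {0..}" "\<And>t. t \<ge> 0 \<Longrightarrow> norm (h t) \<le> \<phi> t"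
  shows "h absolutely_integrable_on {0..}"
proof (rule measurable_bounded_by_integrable_imp_absolutely_integrable)
  show "h \<in> borel_measurable (lebesgue_on {0..})"
    using assms(1) by (rule continuous_imp_measurable_on_sets_lebesgue) auto
qed (use assms in auto)

lemma tendsto_integral_halfline:
  fixes h :: "real \<Rightarrow> 'a::euclidean_space"
  assumes "h absolutely_integrable_on {0..}"
  shows "((\<lambda>T. integral {0..T} h) \<longlongrightarrow> integral {0..} h) at_top"
proof -
  have "((\<lambda>T. LINT t:{0..T}|lebesgue. h t) \<longlongrightarrow> (LINT t:{0..}|lebesgue. h t)) at_top"
    using assms by (intro tendsto_set_lebesgue_integral_at_top) auto
  moreover have "(LINT t:{0..T}|lebesgue. h t) = integral {0..T} h" for T
    by (rule set_lebesgue_integral_eq_integral(2), rule set_integrable_subset[OF assms]) auto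
  ultimately show ?thesis
    using set_lebesgue_integral_eq_integral(2)[OF assms] by simp
qed

text \<open>The bound on the right does not involve \<open>h\<close>: for a family with a common majorant the truncated
  integrals converge uniformly.\<close>

lemma integral_tail_bound:
  fixes h :: "real \<Rightarrow> complex"
  assumes h: "h absolutely_integrable_on {0..}" and \<phi>: "\<phi> absolutely_integrable_on {0..}"
    and bnd: "\<And>t. t \<ge> 0 \<Longrightarrow> norm (h t) \<le> \<phi> t" and "T \<ge> 0"
  shows "norm (integral {0..} h - integral {0..T} h) \<le> integral {0..} \<phi> - integral {0..T} \<phi>"
proof -
  have restrict: "integral {0..} f - integral {0..T} f =
        integral {0..} (\<lambda>t. f t - (if t \<in> {0..T} then f t else 0))"
      "(\<lambda>t. f t - (if t \<in> {0..T} then f t else 0)) integrable_on {0..}"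
    if f: "f absolutely_integrable_on {0..}" for f :: "real \<Rightarrow> 'b::euclidean_space"
  proof -
    have 1: "f integrable_on {0..}" "f integrable_on {0..T}"
      using set_lebesgue_integral_eq_integral(1)[OF f]
        set_lebesgue_integral_eq_integral(1)[OF set_integrable_subset[OF f, of "{0..T}"]] by auto
    have "{0..T} \<inter> {0..} = {0..T}" by auto
    then have 2: "(\<lambda>t. if t \<in> {0..T} then f t else 0) integrable_on {0..}"
        "integral {0..} (\<lambda>t. if t \<in> {0..T} then f t else 0) = integral {0..T} f"
      using 1 integrable_restrict_Int[of "{0..T}" f "{0..}"] integral_restrict_Int[of "{0..}" "{0..T}" f]
      by (auto simp: Int_commute)
    show "integral {0..} f - integral {0..T} f =
        integral {0..} (\<lambda>t. f t - (if t \<in> {0..T} then f t else 0))"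
      using 1 2 by (simp add: integral_diff)
    show "(\<lambda>t. f t - (if t \<in> {0..T} then f t else 0)) integrable_on {0..}"
      using 1 2 by (intro integrable_diff)
  qed
  show ?thesis
    unfolding restrict[OF h] restrict[OF \<phi>]
    by (rule integral_norm_bound_integral[OF restrict(2)[OF h] restrict(2)[OF \<phi>]])
       (use bnd in auto)
qed

text \<open>Differentiation under the integral sign holds on each compact interval; the common majorant
  makes the integrals over \<open>[0, n]\<close> converge uniformly, and uniform limits of holomorphic functions
  are holomorphic.\<close>

lemma holomorphic_on_halfline_integral:
  fixes h h' :: "complex \<Rightarrow> real \<Rightarrow> complex"
  assumes U: "open U" "convex U"
    and deriv: "\<And>w t. w \<in> U \<Longrightarrow> t \<ge> 0 \<Longrightarrow> ((\<lambda>w. h w t) has_field_derivative h' w t) (at w)"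
    and cont: "continuous_on (U \<times> {0..}) (\<lambda>(w, t). h w t)"
    and cont': "continuous_on (U \<times> {0..}) (\<lambda>(w, t). h' w t)"
    and \<phi>: "\<phi> integrable_on {0..}" and bnd: "\<And>w t. w \<in> U \<Longrightarrow> t \<ge> 0 \<Longrightarrow> norm (h w t) \<le> \<phi> t"
  shows "(\<lambda>w. integral {0..} (h w)) holomorphic_on U"
proof (cases "U = {}")
  case False
  have conth: "continuous_on {0..} (h w)" if "w \<in> U" for w
  proof -
    have "continuous_on {0..} (\<lambda>t. (w, t))" by (intro continuous_on_Pair continuous_intros)
    from continuous_on_compose2[OF cont this] that show ?thesis by auto
  qed
  have absh: "h w absolutely_integrable_on {0..}" if "w \<in> U" for w
    using integrable_on_halfline_dominated[OF conth[OF that] \<phi>] bnd that by blast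
  have abs\<phi>: "\<phi> absolutely_integrable_on {0..}"
  proof (rule nonnegative_absolutely_integrable_1[OF \<phi>])
    fix t :: real assume "t \<in> {0..}"
    moreover obtain w where "w \<in> U" using False by blast
    ultimately show "\<phi> t \<ge> 0" using order_trans[OF norm_ge_zero bnd[of w t]] by simp
  qed
  show ?thesis
  proof (rule holomorphic_uniform_sequence[OF U(1)])
    show "(\<lambda>w. integral (cbox 0 (real n)) (h w)) holomorphic_on U" for n
    proof (rule leibniz_rule_holomorphic[where fx = h'])
      show "((\<lambda>w. h w t) has_field_derivative h' w t) (at w within U)"
        if "w \<in> U" "t \<in> cbox 0 (real n)" for w t
        using deriv[of w t] that by (auto intro: has_field_derivative_at_within)
      show "h w integrable_on cbox 0 (real n)" if "w \<in> U" for w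
        by (intro integrable_continuous continuous_on_subset[OF conth[OF that]]) auto
      show "continuous_on (U \<times> cbox 0 (real n)) (\<lambda>(w, t). h' w t)"
        by (rule continuous_on_subset[OF cont']) auto
    qed (rule U(2))
    fix w assume "w \<in> U"
    then obtain d where d: "d > 0" "cball w d \<subseteq> U"
      using open_contains_cball_eq[OF U(1)] by metis
    have "uniform_limit (cball w d) (\<lambda>n w. integral (cbox 0 (real n)) (h w))
            (\<lambda>w. integral {0..} (h w)) sequentially"
    proof (rule uniform_limitI)
      fix e :: real assume "e > 0"
      have "(\<lambda>n. integral {0..real n} \<phi>) \<longlonglongrightarrow> integral {0..} \<phi>"
        by (rule filterlim_compose[OF tendsto_integral_halfline[OF abs\<phi>] filterlim_real_sequentially])
      then have "\<forall>\<^sub>F n in sequentially. dist (integral {0..real n} \<phi>) (integral {0..} \<phi>) < e"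
        using \<open>e > 0\<close> by (rule tendstoD)
      then show "\<forall>\<^sub>F n in sequentially. \<forall>y\<in>cball w d.
          dist (integral (cbox 0 (real n)) (h y)) (integral {0..} (h y)) < e"
      proof eventually_elim
        case (elim n)
        show ?case
        proof
          fix y assume "y \<in> cball w d"
          then have y: "y \<in> U" using d by blast
          have "norm (integral {0..} (h y) - integral {0..real n} (h y)) \<le>
                integral {0..} \<phi> - integral {0..real n} \<phi>"
            by (rule integral_tail_bound[OF absh[OF y] abs\<phi> bnd[OF y]]) auto
          with elim show "dist (integral (cbox 0 (real n)) (h y)) (integral {0..} (h y)) < e"
            by (simp add: dist_norm norm_minus_commute)
        qed
      qed
    qed
    then show "\<exists>d>0. cball w d \<subseteq> U \<and> uniform_limit (cball w d)
        (\<lambda>n w. integral (cbox 0 (real n)) (h w)) (\<lambda>w. integral {0..} (h w)) sequentially"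
      using d by blast
  qed
qed (simp add: holomorphic_on_empty)

section \<open>The Laplace transform of a complex power\<close>

definition laplace_kernel :: "complex \<Rightarrow> complex \<Rightarrow> real \<Rightarrow> complex" where
  "laplace_kernel s w t = of_real t powr (s - 1) * exp (- (w * of_real t))"

lemma norm_laplace_kernel:
  assumes "t \<ge> 0"
  shows "norm (laplace_kernel s w t) = t powr (Re s - 1) * exp (- (Re w * t))"
  using assms by (cases "t = 0") (simp_all add: laplace_kernel_def norm_mult norm_powr_real_powr)

lemma integrable_real_Gamma_kernel:
  fixes \<sigma> \<delta> :: real
  assumes "\<sigma> > 0" "\<delta> > 0"
  shows "(\<lambda>t. t powr (\<sigma> - 1) * exp (- (\<delta> * t))) integrable_on {0..}"
proof -
  have "(\<lambda>t. norm (complex_of_real t powr (of_real \<sigma> - 1) / of_real (exp (\<delta> * t))))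
      absolutely_integrable_on {0<..}"
    using absolutely_integrable_norm[OF absolutely_integrable_Gamma_integral[of "of_real \<sigma>" \<delta>]] assms
    by (simp add: o_def)
  then have "(\<lambda>t. norm (complex_of_real t powr (of_real \<sigma> - 1) / of_real (exp (\<delta> * t)))) integrable_on {0<..}"
    by (rule set_lebesgue_integral_eq_integral(1))
  then have "(\<lambda>t. t powr (\<sigma> - 1) * exp (- (\<delta> * t))) integrable_on {0<..}"
    by (rule integrable_eq) (auto simp: norm_divide norm_powr_real_powr exp_minus field_simps)
  then show ?thesis
    by (rule integrable_spike_set) (auto intro: negligible_subset[of "{0}"])
qed

lemma laplace_kernel_continuous:
  assumes "Re s > 1"
  shows "continuous_on (U \<times> {0..}) (\<lambda>(w, t). laplace_kernel s w t)"
  unfolding laplace_kernel_def case_prod_unfold using assms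
  by (intro continuous_intros) auto

lemma laplace_kernel_absolutely_integrable:
  assumes "Re s > 1" "Re w > 0"
  shows "laplace_kernel s w absolutely_integrable_on {0..}"
proof (rule integrable_on_halfline_dominated)
  show "continuous_on {0..} (laplace_kernel s w)"
    unfolding laplace_kernel_def using assms by (intro continuous_intros) auto
  show "(\<lambda>t. t powr (Re s - 1) * exp (- (Re w * t))) integrable_on {0..}"
    using assms by (intro integrable_real_Gamma_kernel) auto
qed (simp add: norm_laplace_kernel)

text \<open>For real \<open>r\<close> the substitution \<open>t \<mapsto> r t\<close> reduces the integral to Euler's integral for \<open>Gamma s\<close>.\<close>

lemma laplace_kernel_integral_real:
  assumes s: "Re s > 1" and r: "r > 0"
  shows "integral {0..} (laplace_kernel s (of_real r)) = Gamma s / of_real r powr s"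
proof -
  have G: "integral {0..} (laplace_kernel s 1) = Gamma s"
  proof -
    have "laplace_kernel s 1 = (\<lambda>t. of_real t powr (s - 1) / of_real (exp t))"
      by (auto simp: laplace_kernel_def exp_minus exp_of_real field_simps)
    then show ?thesis using integral_unique[OF Gamma_integral_complex[of s]] s by simp
  qed
  have scale: "laplace_kernel s 1 (r * t) = of_real r powr (s - 1) * laplace_kernel s (of_real r) t"
    if "t \<ge> 0" for t
    using that r powr_times_real[of "of_real r" "of_real t" "s - 1"]
    by (simp add: laplace_kernel_def)
  have fin: "integral {0..T} (laplace_kernel s (of_real r)) =
        integral {0..r * T} (laplace_kernel s 1) / of_real r powr s" if "T \<ge> 0" for T
  proof -
    have "laplace_kernel s 1 integrable_on {0..r * T}"
      unfolding laplace_kernel_def using s by (intro integrable_continuous_interval continuous_intros) auto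
    then have "((\<lambda>t. laplace_kernel s 1 (r * t)) has_integral
        (1 / \<bar>r\<bar>) *\<^sub>R integral {0..r * T} (laplace_kernel s 1)) ((\<lambda>x. x / r) ` {0..r * T})"
      using r by (intro has_integral_stretch_real integrable_integral) auto
    also have "(\<lambda>x. x / r) ` {0..r * T} = {0..T}"
      using r that image_divide_atLeastAtMost[of r 0 "r * T"] by simp
    finally have "((\<lambda>t. of_real r powr (s - 1) * laplace_kernel s (of_real r) t) has_integral
        (1 / \<bar>r\<bar>) *\<^sub>R integral {0..r * T} (laplace_kernel s 1)) {0..T}"
      by (rule has_integral_eq[rotated]) (simp add: scale)
    from integral_unique[OF this] show ?thesis
      using r by (simp add: powr_diff scaleR_conv_of_real field_simps)
  qed
  have lim1: "((\<lambda>T. integral {0..r * T} (laplace_kernel s 1) / of_real r powr s) \<longlongrightarrow>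
        integral {0..} (laplace_kernel s 1) / of_real r powr s) at_top"
    using s r by (intro tendsto_divide tendsto_const filterlim_compose[OF tendsto_integral_halfline]
        laplace_kernel_absolutely_integrable filterlim_tendsto_pos_mult_at_top[OF tendsto_const] filterlim_ident) auto
  have lim: "((\<lambda>T. integral {0..T} (laplace_kernel s (of_real r))) \<longlongrightarrow>
        integral {0..} (laplace_kernel s (of_real r))) at_top"
    using s r by (intro tendsto_integral_halfline laplace_kernel_absolutely_integrable) auto
  have ev: "\<forall>\<^sub>F T in at_top. integral {0..r * T} (laplace_kernel s 1) / of_real r powr s =
        integral {0..T} (laplace_kernel s (of_real r))"
    using eventually_ge_at_top[of 0] by eventually_elim (rule fin[symmetric])
  have "((\<lambda>T. integral {0..T} (laplace_kernel s (of_real r))) \<longlongrightarrow>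
        integral {0..} (laplace_kernel s 1) / of_real r powr s) at_top"
    by (rule Lim_transform_eventually[OF lim1 ev])
  then show ?thesis
    unfolding G by (rule tendsto_unique[OF trivial_limit_at_top_linorder lim])
qed

text \<open>A complex substitution would need a rotation of the path. Instead, both sides are holomorphic in
  \<open>w\<close> on the right half-plane and agree on the positive real axis.\<close>

lemma laplace_kernel_integral:
  assumes s: "Re s > 1" and w: "Re w > 0"
  shows "integral {0..} (laplace_kernel s w) = Gamma s / w powr s"
proof -
  let ?H = "{w. Re w > 0}"
  have "(\<lambda>w. integral {0..} (laplace_kernel s w)) holomorphic_on ?H"
  proof (rule holomorphic_on_locally)
    fix w0 :: complex assume "w0 \<in> ?H"
    \<comment> \<open>On this half-plane the kernels have a common integrable majorant.\<close>
    define V where "V = {w. Re w > Re w0 / 2}"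
    have "(\<lambda>w. integral {0..} (laplace_kernel s w)) holomorphic_on V"
    proof (rule holomorphic_on_halfline_integral)
      show "open V" "convex V"
        unfolding V_def by (rule open_halfspace_Re_gt convex_halfspace_Re_gt)+
      show "((\<lambda>w. laplace_kernel s w t) has_field_derivative (- of_real t * laplace_kernel s w t)) (at w)" for w t
        unfolding laplace_kernel_def by (auto intro!: derivative_eq_intros)
      show "continuous_on (V \<times> {0..}) (\<lambda>(w, t). laplace_kernel s w t)"
        using s by (rule laplace_kernel_continuous)
      then show "continuous_on (V \<times> {0..}) (\<lambda>(w, t). - of_real t * laplace_kernel s w t)"
        unfolding case_prod_unfold by (intro continuous_intros)
      show "(\<lambda>t. t powr (Re s - 1) * exp (- (Re w0 / 2 * t))) integrable_on {0..}"
        using s \<open>w0 \<in> ?H\<close> by (intro integrable_real_Gamma_kernel) auto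
      show "norm (laplace_kernel s w t) \<le> t powr (Re s - 1) * exp (- (Re w0 / 2 * t))"
        if "w \<in> V" "t \<ge> 0" for w t
        unfolding norm_laplace_kernel[OF that(2)] using that
        mult_right_mono[of "Re w0 / 2" "Re w" t]
        by (intro mult_left_mono) (auto simp: V_def)
    qed
    moreover have "open V" unfolding V_def by (rule open_halfspace_Re_gt)
    ultimately show "\<exists>V. open V \<and> w0 \<in> V \<and> (\<lambda>w. integral {0..} (laplace_kernel s w)) holomorphic_on V"
      using \<open>w0 \<in> ?H\<close> by (intro exI[of _ V] conjI) (auto simp: V_def)
  qed
  moreover have "(\<lambda>w. Gamma s / w powr s) holomorphic_on ?H"
    by (intro holomorphic_intros) (auto simp: complex_nonpos_Reals_iff)
  ultimately have "(\<lambda>w. integral {0..} (laplace_kernel s w) - Gamma s / w powr s) holomorphic_on ?H"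
    by (rule holomorphic_on_diff)
  then have "integral {0..} (laplace_kernel s w) - Gamma s / w powr s = 0"
  proof (rule analytic_continuation[where U = "complex_of_real ` {0<..}" and \<xi> = 1])
    show "open ?H" by (rule open_halfspace_Re_gt)
    show "connected ?H" by (intro convex_connected convex_halfspace_Re_gt)
    show "complex_of_real ` {0<..} \<subseteq> ?H" "1 \<in> ?H" "w \<in> ?H" using w by auto
    show "integral {0..} (laplace_kernel s z) - Gamma s / z powr s = 0"
      if "z \<in> complex_of_real ` {0<..}" for z
      using that laplace_kernel_integral_real[OF s] by auto
    show "1 islimpt complex_of_real ` {0<..}"
      unfolding islimpt_approachable
    proof (intro allI impI)
      fix e :: real assume "e > 0"
      then show "\<exists>x'\<in>complex_of_real ` {0<..}. x' \<noteq> 1 \<and> dist x' 1 < e"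
        by (intro bexI[of _ "of_real (1 + e / 2)"] imageI) (auto simp: dist_norm)
    qed
  qed
  then show ?thesis by simp
qed

section \<open>Continuation in z to the slit plane\<close>

abbreviation slit_plane :: "complex set" where
  "slit_plane \<equiv> - (complex_of_real ` {1..})"

lemma in_slit_plane_iff: "z \<in> slit_plane \<longleftrightarrow> Im z \<noteq> 0 \<or> Re z < 1"
  by (auto simp: image_iff complex_eq_iff)

lemma open_slit_plane: "open slit_plane"
proof -
  have "slit_plane = {z. Im z \<noteq> 0} \<union> {z. Re z < 1}"
    using in_slit_plane_iff by blast
  moreover have "open {z. Im z \<noteq> 0}"
    by (intro open_Collect_neq continuous_intros)
  ultimately show ?thesis
    by (simp only: open_Un open_halfspace_Re_lt)
qed

lemma slit_plane_scaled:
  assumes "z \<in> slit_plane" "0 \<le> t" "t \<le> 1"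
  shows "of_real t * z \<in> slit_plane"
proof -
  have "t * Re z < 1" if "Re z < 1"
    using assms that mult_left_mono[of "Re z" 1 t] by (cases "t = 1") auto
  then show ?thesis
    using assms unfolding in_slit_plane_iff by (cases "t = 0") auto
qed

lemma unit_disc_subset_slit_plane: "norm z < 1 \<Longrightarrow> z \<in> slit_plane"
  unfolding in_slit_plane_iff using complex_Re_le_cmod[of z] by auto

lemma one_minus_neq_0_slit_plane: "z \<in> slit_plane \<Longrightarrow> 0 \<le> x \<Longrightarrow> x \<le> 1 \<Longrightarrow> 1 - z * of_real x \<noteq> 0"
  using slit_plane_scaled[of z x] by (auto simp: in_slit_plane_iff mult.commute)

text \<open>The slit plane is star-shaped about \<open>0\<close>, and \<open>(t z) ^ N = t ^ N z ^ N\<close>; so its preimage under the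
  \<open>N\<close>-th power, a plane with \<open>N\<close> radial slits, is star-shaped as well. Connectedness is what allows the
  identity theorem to carry the multiplication formula out of the disc.\<close>

lemma connected_power_slit_plane:
  assumes "N > 0"
  shows "connected {z. z ^ N \<in> slit_plane}"
proof (rule starlike_imp_connected, unfold starlike_def, intro bexI ballI)
  show "0 \<in> {z. z ^ N \<in> slit_plane}" using assms unit_disc_subset_slit_plane[of 0] by (simp add: power_0_left)
  show "closed_segment 0 z \<subseteq> {z. z ^ N \<in> slit_plane}" if z: "z \<in> {z. z ^ N \<in> slit_plane}" for z
  proof
    fix y assume "y \<in> closed_segment 0 z"
    then obtain t where t: "0 \<le> t" "t \<le> 1" "y = of_real t * z"
      by (auto simp: closed_segment_def scaleR_conv_of_real)
    have "of_real (t ^ N) * z ^ N \<in> slit_plane"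
      using z t by (intro slit_plane_scaled power_le_one) auto
    then show "y \<in> {z. z ^ N \<in> slit_plane}"
      by (simp add: t(3) power_mult_distrib)
  qed
qed

lemma one_minus_exp_neq_0_slit_plane:
  assumes "z \<in> slit_plane" "0 \<le> t"
  shows "z * of_real (exp (- t)) \<noteq> 1"
  using one_minus_neq_0_slit_plane[of z "exp (- t)"] assms by simp

text \<open>Summing \<open>z ^ j * exp (- (j + v) t)\<close> as a geometric series: up to the factor \<open>Gamma s\<close>, the integral over
  \<open>t\<close> is the Lerch function, and the integrand is singular in \<open>z\<close> only on \<open>[1, \<infinity>)\<close>.\<close>

definition lerch_integrand :: "complex \<Rightarrow> complex \<Rightarrow> complex \<Rightarrow> real \<Rightarrow> complex" where
  "lerch_integrand s v z t = laplace_kernel s v t / (1 - z * of_real (exp (- t)))"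

lemma lerch_integrand_continuous:
  assumes "Re s > 1" "U \<subseteq> slit_plane"
  shows "continuous_on (U \<times> {0..}) (\<lambda>(z, t). lerch_integrand s v z t)"
proof -
  have "x * of_real (exp (- t)) \<noteq> 1" if "x \<in> U" "t \<ge> 0" for x t
    using one_minus_exp_neq_0_slit_plane assms that by blast
  then show ?thesis
    unfolding lerch_integrand_def laplace_kernel_def case_prod_unfold using assms(1)
    by (intro continuous_intros) auto
qed

lemma lerch_integral_holomorphic:
  assumes s: "Re s > 1" and v: "Re v > 0"
  shows "(\<lambda>z. integral {0..} (lerch_integrand s v z)) holomorphic_on slit_plane"
proof (rule holomorphic_on_locally)
  fix z0 assume "z0 \<in> slit_plane"
  then obtain d where d: "d > 0" "cball z0 d \<subseteq> slit_plane"
    using open_contains_cball_eq[OF open_slit_plane] by metis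
  have sub: "ball z0 d \<subseteq> slit_plane" using d(2) ball_subset_cball by blast
  have "\<exists>p\<in>cball z0 d \<times> {0..1}. \<forall>q\<in>cball z0 d \<times> {0..1}.
      norm (1 - fst p * of_real (snd p)) \<le> norm (1 - fst q * of_real (snd q))"
    using d(1) by (intro continuous_attains_inf compact_Times continuous_intros) auto
  then obtain p where p: "p \<in> cball z0 d \<times> {0..1}" "\<forall>q\<in>cball z0 d \<times> {0..1}.
      norm (1 - fst p * of_real (snd p)) \<le> norm (1 - fst q * of_real (snd q))" by blast
  \<comment> \<open>The denominator is bounded away from \<open>0\<close> by compactness of the parameters \<open>(z, exp (- t))\<close>.\<close>
  define m where "m = norm (1 - fst p * of_real (snd p))"
  have m: "m > 0"
    unfolding m_def using p(1) d(2) one_minus_neq_0_slit_plane[of "fst p" "snd p"] by auto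
  have m_le: "m \<le> norm (1 - z * of_real (exp (- t)))" if "z \<in> ball z0 d" "t \<ge> 0" for z t
    unfolding m_def using p(2)[rule_format, of "(z, exp (- t))"] that by auto
  have nz: "x * of_real (exp (- t)) \<noteq> 1" if "x \<in> ball z0 d" "t \<ge> 0" for x t
    using one_minus_exp_neq_0_slit_plane sub that by blast
  have "(\<lambda>z. integral {0..} (lerch_integrand s v z)) holomorphic_on ball z0 d"
  proof (rule holomorphic_on_halfline_integral)
    show "((\<lambda>z. lerch_integrand s v z t) has_field_derivative
        lerch_integrand s v z t * of_real (exp (- t)) / (1 - z * of_real (exp (- t)))) (at z)"
      if "z \<in> ball z0 d" "t \<ge> 0" for z t
    proof -
      have "1 - z * of_real (exp (- t)) \<noteq> 0"
        using m m_le[OF that] by auto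
      then show ?thesis
        unfolding lerch_integrand_def
        by (auto intro!: derivative_eq_intros simp: power2_eq_square)
    qed
    show "continuous_on (ball z0 d \<times> {0..}) (\<lambda>(z, t). lerch_integrand s v z t)"
      by (rule lerch_integrand_continuous[OF s sub])
    then show "continuous_on (ball z0 d \<times> {0..}) (\<lambda>(z, t).
        lerch_integrand s v z t * of_real (exp (- t)) / (1 - z * of_real (exp (- t))))"
      unfolding case_prod_unfold using nz
      by (intro continuous_intros) auto
    show "(\<lambda>t. t powr (Re s - 1) * exp (- (Re v * t)) / m) integrable_on {0..}"
      using s v integrable_real_Gamma_kernel[of "Re s" "Re v"] by (intro integrable_on_divide) auto
    show "norm (lerch_integrand s v z t) \<le> t powr (Re s - 1) * exp (- (Re v * t)) / m"
      if "z \<in> ball z0 d" "t \<ge> 0" for z t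
      unfolding lerch_integrand_def norm_divide norm_laplace_kernel[OF that(2)]
      using m m_le[OF that] by (intro divide_left_mono mult_pos_pos) auto
  qed auto
  then show "\<exists>V. open V \<and> z0 \<in> V \<and> (\<lambda>z. integral {0..} (lerch_integrand s v z)) holomorphic_on V"
    using d(1) by (intro exI[of _ "ball z0 d"]) auto
qed

text \<open>The first \<open>n\<close> terms of the geometric series integrate to the partial sums of the Lerch series by
  \<open>laplace_kernel_integral\<close>; the rest of the integral is \<open>O(norm z ^ n)\<close>.\<close>

lemma lerch_integral_eq_series:
  assumes s: "Re s > 1" and v: "Re v > 0" and z: "norm z < 1"
  shows "integral {0..} (lerch_integrand s v z) = Gamma s * lerch_series z s v"
proof -
  define q where "q = (\<lambda>t. z * of_real (exp (- t)))"
  have q: "norm (q t) \<le> norm z" "norm (1 - q t) \<ge> 1 - norm z" if "t \<ge> 0" for t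
  proof -
    show 1: "norm (q t) \<le> norm z"
      using that by (simp add: q_def norm_mult mult_left_le)
    show "norm (1 - q t) \<ge> 1 - norm z"
      using norm_triangle_ineq2[of 1 "q t"] 1 by simp
  qed
  have q1: "1 - q t \<noteq> 0" if "t \<ge> 0" for t using q(2)[OF that] z by auto
  define \<phi> where "\<phi> = (\<lambda>t. t powr (Re s - 1) * exp (- (Re v * t)))"
  have \<phi>: "\<phi> integrable_on {0..}"
    unfolding \<phi>_def using s v by (intro integrable_real_Gamma_kernel) auto
  have k_int: "laplace_kernel s (of_nat j + v) integrable_on {0..}" for j
    using s v by (intro set_lebesgue_integral_eq_integral(1) laplace_kernel_absolutely_integrable) auto
  have h_int: "lerch_integrand s v z integrable_on {0..}"
  proof (rule set_lebesgue_integral_eq_integral(1)[OF integrable_on_halfline_dominated])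
    have "continuous_on {0..} (\<lambda>t. (z, t))" by (intro continuous_on_Pair continuous_intros)
    from continuous_on_compose2[OF lerch_integrand_continuous[OF s, of "{z}"] this]
    show "continuous_on {0..} (lerch_integrand s v z)"
      using unit_disc_subset_slit_plane[OF z] by auto
    show "(\<lambda>t. \<phi> t / (1 - norm z)) integrable_on {0..}"
      using \<phi> by (rule integrable_on_divide)
    show "norm (lerch_integrand s v z t) \<le> \<phi> t / (1 - norm z)" if "t \<ge> 0" for t
      unfolding lerch_integrand_def norm_divide norm_laplace_kernel[OF that] \<phi>_def
      using z q[OF that] q1[OF that] by (intro divide_left_mono mult_pos_pos) (auto simp: q_def)
  qed
  have partial: "lerch_integrand s v z t - (\<Sum>j<n. z ^ j * laplace_kernel s (of_nat j + v) t) =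
      q t ^ n * (laplace_kernel s v t / (1 - q t))" if "t \<ge> 0" for n t
  proof -
    have "z ^ j * laplace_kernel s (of_nat j + v) t = laplace_kernel s v t * q t ^ j" for j
    proof -
      have "exp (- ((of_nat j + v) * of_real t)) = exp (- (v * of_real t)) * exp (of_nat j * (- of_real t))"
        by (simp add: exp_add[symmetric] algebra_simps)
      also have "exp (of_nat j * (- of_real t)) = complex_of_real (exp (- t)) ^ j"
        by (simp only: exp_of_nat_mult exp_of_real[symmetric] of_real_minus)
      finally show ?thesis by (simp add: laplace_kernel_def q_def power_mult_distrib)
    qed
    then have "(\<Sum>j<n. z ^ j * laplace_kernel s (of_nat j + v) t) = laplace_kernel s v t * (\<Sum>j<n. q t ^ j)"
      by (simp add: sum_distrib_left)
    also have "(\<Sum>j<n. q t ^ j) = (1 - q t ^ n) / (1 - q t)"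
      using q1[OF that] sum_gp_strict[of "q t" n] by auto
    finally show ?thesis
      using q1[OF that] by (simp add: lerch_integrand_def q_def field_simps)
  qed
  have bound: "norm (integral {0..} (lerch_integrand s v z) -
      (\<Sum>j<n. z ^ j * (Gamma s / (of_nat j + v) powr s))) \<le> norm z ^ n * (integral {0..} \<phi> / (1 - norm z))" for n
  proof -
    have "(\<Sum>j<n. z ^ j * (Gamma s / (of_nat j + v) powr s)) =
        integral {0..} (\<lambda>t. \<Sum>j<n. z ^ j * laplace_kernel s (of_nat j + v) t)"
      using k_int s v by (simp add: integral_sum laplace_kernel_integral integrable_on_mult_right)
    then have "integral {0..} (lerch_integrand s v z) -
        (\<Sum>j<n. z ^ j * (Gamma s / (of_nat j + v) powr s)) =
        integral {0..} (\<lambda>t. lerch_integrand s v z t - (\<Sum>j<n. z ^ j * laplace_kernel s (of_nat j + v) t))"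
      using h_int k_int by (simp add: integral_diff integrable_sum integrable_on_mult_right)
    also have "norm \<dots> \<le> integral {0..} (\<lambda>t. norm z ^ n * (\<phi> t / (1 - norm z)))"
    proof (rule integral_norm_bound_integral)
      show "(\<lambda>t. lerch_integrand s v z t - (\<Sum>j<n. z ^ j * laplace_kernel s (of_nat j + v) t)) integrable_on {0..}"
        using h_int k_int by (intro integrable_diff integrable_sum integrable_on_mult_right) auto
      show "(\<lambda>t. norm z ^ n * (\<phi> t / (1 - norm z))) integrable_on {0..}"
        using \<phi> by (intro integrable_on_mult_right integrable_on_divide)
      fix t :: real assume "t \<in> {0..}"
      then have t: "t \<ge> 0" by simp
      have "norm (q t ^ n * (laplace_kernel s v t / (1 - q t))) =
          norm (q t) ^ n * (\<phi> t / norm (1 - q t))"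
        by (simp add: norm_mult norm_power norm_divide norm_laplace_kernel[OF t] \<phi>_def)
      also have "\<dots> \<le> norm z ^ n * (\<phi> t / (1 - norm z))"
        using z q[OF t] q1[OF t]
        by (intro mult_mono power_mono divide_left_mono mult_pos_pos) (auto simp: \<phi>_def)
      finally show "norm (lerch_integrand s v z t - (\<Sum>j<n. z ^ j * laplace_kernel s (of_nat j + v) t))
          \<le> norm z ^ n * (\<phi> t / (1 - norm z))"
        unfolding partial[OF t] .
    qed
    finally show ?thesis by simp
  qed
  have "(\<lambda>n. norm z ^ n * (integral {0..} \<phi> / (1 - norm z))) \<longlonglongrightarrow> 0"
    using z by (intro tendsto_mult_left_zero LIMSEQ_power_zero) auto
  then have "(\<lambda>n. integral {0..} (lerch_integrand s v z) -
      (\<Sum>j<n. z ^ j * (Gamma s / (of_nat j + v) powr s))) \<longlonglongrightarrow> 0"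
    by (rule Lim_null_comparison[OF always_eventually[OF allI[OF bound]]])
  then have "(\<lambda>j. z ^ j * (Gamma s / (of_nat j + v) powr s)) sums integral {0..} (lerch_integrand s v z)"
    unfolding sums_def by (rule Lim_null[THEN iffD2, OF tendsto_minus_cancel, simplified])
  moreover have "(\<lambda>j. Gamma s * (z ^ j / (of_nat j + v) powr s)) sums (Gamma s * lerch_series z s v)"
    unfolding lerch_series_def using s z
    by (intro sums_mult summable_sums summable_norm_cancel[OF lerch_term_summable]) auto
  ultimately show ?thesis
    using sums_unique2 by (fastforce simp: mult_ac)
qed

text \<open>The integral covers \<open>Re s > 1\<close>. If \<open>f\<close> continues the series of exponent \<open>s + 1\<close>, then
  \<open>v f + z f'\<close> continues that of exponent \<open>s\<close>, which reaches every exponent by induction.\<close>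

theorem lerch_slit_plane_continuation:
  assumes v: "v \<notin> \<int>\<^sub>\<le>\<^sub>0"
  shows "\<exists>f. f holomorphic_on slit_plane \<and> (\<forall>z. norm z < 1 \<longrightarrow> f z = lerch_series z s v)"
proof -
  have *: "\<exists>f. f holomorphic_on slit_plane \<and> (\<forall>z. norm z < 1 \<longrightarrow> f z = lerch_series z s v)"
    if "Re s + real n > 1" for n s
    using that
  proof (induction n arbitrary: s)
    case 0
    then have s: "Re s > 1" by simp
    obtain K where K: "Re (v + of_nat K) \<ge> 1" using shift_to_Re_ge .
    define f where "f = (\<lambda>z. (\<Sum>j<K. z ^ j / (of_nat j + v) powr s) +
        z ^ K * (integral {0..} (lerch_integrand s (v + of_nat K) z) / Gamma s))"
    have G: "Gamma s \<noteq> 0"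
      using Re_ge_1_nonpos_Ints[of s] s by (simp add: Gamma_eq_zero_iff)
    have "f holomorphic_on slit_plane"
      unfolding f_def using plus_of_nat_nonzero[OF v] K s G
      by (intro holomorphic_intros lerch_integral_holomorphic) auto
    moreover have "f z = lerch_series z s v" if "norm z < 1" for z
      using lerch_integral_eq_series[of s "v + of_nat K" z] that K s G lerch_series_shift[OF v, of z s K]
      by (simp add: f_def)
    ultimately show ?case by blast
  next
    case (Suc n)
    have "\<exists>f. f holomorphic_on slit_plane \<and> (\<forall>z. norm z < 1 \<longrightarrow> f z = lerch_series z (s + 1) v)"
      by (rule Suc.IH) (use Suc.prems in simp)
    then obtain f where f: "f holomorphic_on slit_plane"
        "\<And>z. norm z < 1 \<Longrightarrow> f z = lerch_series z (s + 1) v" by blast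
    define g where "g = (\<lambda>z. v * f z + z * deriv f z)"
    have "g holomorphic_on slit_plane"
      unfolding g_def using open_slit_plane by (intro holomorphic_intros f(1) holomorphic_deriv)
    moreover have "g z = lerch_series z s v" if z: "norm z < 1" for z
    proof -
      define c where "c = (\<lambda>j. 1 / (of_nat j + v) powr (s + 1))"
      have ser: "lerch_series z (s + 1) v = (\<Sum>j. c j * z ^ j)" for z
        by (simp add: lerch_series_def c_def)
      have "summable (\<lambda>j. c j * z ^ j)" if "norm z < 1" for z
        using lerch_term_summable_closed_disc[OF v, of z "s + 1"] that by (simp add: c_def)
      from euler_operator_power_series[OF this z, of v]
      have "lerch_series z s v = v * (\<Sum>j. c j * z ^ j) + z * deriv (\<lambda>z. \<Sum>j. c j * z ^ j) z"
        unfolding lerch_series_def lerch_term_lower[OF v] c_def by (simp add: sums_iff)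
      moreover have "deriv f z = deriv (\<lambda>z. \<Sum>j. c j * z ^ j) z"
      proof (rule deriv_cong_ev[OF eventually_mono[OF eventually_nhds_in_open[of "ball 0 1"]]])
        show "f x = (\<Sum>j. c j * x ^ j)" if "x \<in> ball 0 1" for x
          using f(2)[of x] that ser by simp
      qed (use z in auto)
      ultimately show ?thesis
        using f(2)[OF z] ser by (simp add: g_def)
    qed
    ultimately show ?case by blast
  qed
  obtain n :: nat where "real n > 1 - Re s" using reals_Archimedean2 by blast
  then show ?thesis by (intro *[of s n]) simp
qed

section \<open>The multiplication formula\<close>

text \<open>Any one continuation computes the definite description, because the identity theorem on the
  connected slit plane makes the continuation unique. The same argument in the variable \<open>s\<close> serves
  the Hurwitz zeta function below.\<close>

lemma lerch_phi_eq_slit_plane_continuation: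
  assumes f: "f holomorphic_on slit_plane" "\<And>z. norm z < 1 \<Longrightarrow> f z = lerch_series z s v"
    and z: "z \<in> slit_plane" "\<not> (norm z < 1 \<or> norm z = 1 \<and> Re s > 1)"
  shows "lerch_phi z s v = f z"
proof -
  have "z \<noteq> 1" using z(1) by (auto simp: in_slit_plane_iff simp del: ComplI Compl_iff)
  then have "lerch_phi z s v =
      (THE y. \<exists>f. f holomorphic_on slit_plane \<and> (\<forall>z'. norm z' < 1 \<longrightarrow> f z' = lerch_series z' s v) \<and> f z = y)"
    using z(2) by (simp only: lerch_phi_def if_False)
  also have "\<dots> = f z"
  proof (rule the_equality)
    show "\<exists>g. g holomorphic_on slit_plane \<and> (\<forall>z'. norm z' < 1 \<longrightarrow> g z' = lerch_series z' s v) \<and> g z = f z"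
      using f by blast
    fix y assume "\<exists>g. g holomorphic_on slit_plane \<and> (\<forall>z'. norm z' < 1 \<longrightarrow> g z' = lerch_series z' s v) \<and> g z = y"
    then obtain g where g: "g holomorphic_on slit_plane" "\<And>z. norm z < 1 \<Longrightarrow> g z = lerch_series z s v" "g z = y"
      by blast
    have "g z = f z"
    proof (rule analytic_continuation_open[of "ball 0 1" slit_plane g f z])
      show "ball 0 1 \<subseteq> slit_plane" using unit_disc_subset_slit_plane by (metis mem_ball_0 subsetI)
      show "connected slit_plane" using connected_power_slit_plane[of 1] by (simp del: Compl_iff)
      show "g z = f z" if "z \<in> ball 0 1" for z using that f(2) g(2) by simp
    qed (use f g z open_slit_plane in auto)
    then show "y = f z" using g(3) by simp
  qed
  finally show ?thesis .
qed

lemma hurwitz_zeta_eq_continuation: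
  assumes f: "f holomorphic_on - {1}" "\<And>s. Re s > 1 \<Longrightarrow> f s = lerch_series 1 s v" and s: "s \<noteq> 1"
  shows "hurwitz_zeta s v = f s"
  unfolding hurwitz_zeta_def
proof (rule the_equality)
  show "\<exists>g. g holomorphic_on - {1} \<and> (\<forall>s'. Re s' > 1 \<longrightarrow> g s' = lerch_series 1 s' v) \<and> g s = f s"
    using f by blast
  fix y assume "\<exists>g. g holomorphic_on - {1} \<and> (\<forall>s'. Re s' > 1 \<longrightarrow> g s' = lerch_series 1 s' v) \<and> g s = y"
  then obtain g where g: "g holomorphic_on - {1}" "\<And>s. Re s > 1 \<Longrightarrow> g s = lerch_series 1 s v" "g s = y"
    by blast
  have "g s = f s"
  proof (rule analytic_continuation_open[of "{s. Re s > 1}" "- {1}" g f s])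
    show "{s. Re s > 1} \<noteq> {}" by (auto intro: exI[of _ 2])
    show "connected (- {1 :: complex})" by (rule connected_punctured_universe) simp
    show "g z = f z" if "z \<in> {s. Re s > 1}" for z using that f(2) g(2) by simp
  qed (use f g s open_halfspace_Re_gt in auto)
  then show "y = f s" using g(3) by simp
qed

lemma divided_shift_notin_nonpos_Ints:
  fixes v :: complex
  assumes "v \<notin> \<int>\<^sub>\<le>\<^sub>0" "N > 0"
  shows "(v + of_nat r) / of_nat N \<notin> \<int>\<^sub>\<le>\<^sub>0"
proof
  assume "(v + of_nat r) / of_nat N \<in> \<int>\<^sub>\<le>\<^sub>0"
  then obtain m where "(v + of_nat r) / of_nat N = - of_nat m" by (elim nonpos_Ints_cases')
  then have "v + of_nat r = - of_nat m * of_nat N" using assms(2) by (simp add: field_simps)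
  then have "v + of_nat r + of_nat m * of_nat N = 0" by simp
  then have "of_nat (m * N + r) + v = 0" by (simp add: add_ac)
  then show False using plus_of_nat_nonzero[OF assms(1)] by blast
qed

text \<open>Sort the terms by the residue \<open>r\<close> of the index modulo \<open>N\<close> and pull the factor \<open>N\<close> out of
  \<open>n N + r + v = N (n + (v + r) / N)\<close>. Since \<open>N\<close> is a positive real number, this does not disturb the
  principal branch.\<close>

lemma lerch_series_multiplication:
  assumes v: "v \<notin> \<int>\<^sub>\<le>\<^sub>0" and N: "N > 0" and zs: "norm z < 1 \<or> norm z = 1 \<and> Re s > 1"
  shows "(\<Sum>r<N. z ^ r * lerch_series (z ^ N) s ((v + of_nat r) / of_nat N)) =
           of_nat N powr s * lerch_series z s v"
proof -
  let ?a = "\<lambda>i. of_nat N powr s * (z ^ i / (of_nat i + v) powr s)"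
  have zN: "norm (z ^ N) < 1 \<or> norm (z ^ N) = 1 \<and> Re s > 1"
    using zs N by (auto simp: norm_power power_less_one_iff)
  have "?a sums (of_nat N powr s * lerch_series z s v)"
    unfolding lerch_series_def by (intro sums_mult summable_sums lerch_term_summable_closed_disc v zs)
  from sums_group[OF this N]
  have 1: "(\<lambda>n. sum ?a {n * N..<n * N + N}) sums (of_nat N powr s * lerch_series z s v)" .
  have shift: "?a (r + n * N) = z ^ r * ((z ^ N) ^ n / (of_nat n + (v + of_nat r) / of_nat N) powr s)" for n r
  proof -
    have "of_nat (r + n * N) + v = of_nat N * (of_nat n + (v + of_nat r) / of_nat N)"
      using N by (simp add: field_simps)
    also have "\<dots> powr s = of_nat N powr s * (of_nat n + (v + of_nat r) / of_nat N) powr s"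
      using N by (intro powr_times_real_left) auto
    finally have "(of_nat (r + n * N) + v) powr s =
        of_nat N powr s * (of_nat n + (v + of_nat r) / of_nat N) powr s" .
    moreover have "z ^ (r + n * N) = z ^ r * (z ^ N) ^ n"
      by (simp add: power_add power_mult mult.commute)
    ultimately show ?thesis using N by simp
  qed
  have "sum ?a {n * N..<n * N + N} =
      (\<Sum>r<N. z ^ r * ((z ^ N) ^ n / (of_nat n + (v + of_nat r) / of_nat N) powr s))" for n
    unfolding shift[symmetric] using sum.shift_bounds_nat_ivl[of ?a 0 "n * N" N]
    by (simp add: add.commute lessThan_atLeast0)
  moreover have "(\<lambda>n. \<Sum>r<N. z ^ r * ((z ^ N) ^ n / (of_nat n + (v + of_nat r) / of_nat N) powr s)) sums
      (\<Sum>r<N. z ^ r * lerch_series (z ^ N) s ((v + of_nat r) / of_nat N))"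
    unfolding lerch_series_def
    by (intro sums_sum sums_mult summable_sums lerch_term_summable_closed_disc
        divided_shift_notin_nonpos_Ints v N zN)
  ultimately show ?thesis using 1 sums_unique2 by simp
qed

text \<open>Both sides are holomorphic where \<open>z ^ N\<close> avoids the slit, and they agree in the unit disc.\<close>

lemma lerch_phi_multiplication_slit_plane:
  assumes v: "v \<notin> \<int>\<^sub>\<le>\<^sub>0" and N: "N > 0" and z: "z ^ N \<in> slit_plane"
    and zs: "\<not> (norm z < 1 \<or> norm z = 1 \<and> Re s > 1)"
  shows "(\<Sum>r<N. z ^ r * lerch_phi (z ^ N) s ((v + of_nat r) / of_nat N)) =
           of_nat N powr s * lerch_phi z s v"
proof -
  define w where "w = (\<lambda>r. (v + of_nat r) / of_nat N)"
  have w: "w r \<notin> \<int>\<^sub>\<le>\<^sub>0" for r unfolding w_def by (rule divided_shift_notin_nonpos_Ints[OF v N])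
  let ?\<Omega> = "{z. z ^ N \<in> slit_plane}"
  have sub: "?\<Omega> \<subseteq> slit_plane"
  proof
    fix z assume "z \<in> ?\<Omega>"
    show "z \<in> slit_plane"
    proof
      assume "z \<in> complex_of_real ` {1..}"
      then obtain x where "x \<ge> 1" "z = of_real x" by auto
      then have "z ^ N = of_real (x ^ N)" "x ^ N \<ge> 1" by auto
      then have "z ^ N \<in> complex_of_real ` {1..}" by blast
      then show False using \<open>z \<in> ?\<Omega>\<close> by simp
    qed
  qed
  obtain f where f: "f holomorphic_on slit_plane" "\<And>z. norm z < 1 \<Longrightarrow> f z = lerch_series z s v"
    using lerch_slit_plane_continuation[OF v] by blast
  obtain g where g: "\<And>r. g r holomorphic_on slit_plane"
      "\<And>r z. norm z < 1 \<Longrightarrow> g r z = lerch_series z s (w r)"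
    using lerch_slit_plane_continuation[OF w, where s = s] by metis
  have "(\<Sum>r<N. z ^ r * g r (z ^ N)) = of_nat N powr s * f z"
  proof (rule analytic_continuation_open[of "ball 0 1" ?\<Omega>
        "\<lambda>z. \<Sum>r<N. z ^ r * g r (z ^ N)" "\<lambda>z. of_nat N powr s * f z" z])
    show "open ?\<Omega>"
      using open_vimage[OF open_slit_plane, of "\<lambda>z. z ^ N"] by (simp add: vimage_def continuous_on_power)
    show "connected ?\<Omega>" by (rule connected_power_slit_plane[OF N])
    show "ball 0 1 \<subseteq> ?\<Omega>"
    proof
      fix z :: complex assume "z \<in> ball 0 1"
      then have "norm (z ^ N) < 1" using N by (simp add: norm_power power_less_one_iff)
      then show "z \<in> ?\<Omega>" using unit_disc_subset_slit_plane by blast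
    qed
    have "(g r \<circ> (\<lambda>z. z ^ N)) holomorphic_on ?\<Omega>" for r
      by (intro holomorphic_on_compose_gen[OF _ g(1)] holomorphic_intros) auto
    then have "(\<lambda>z. g r (z ^ N)) holomorphic_on ?\<Omega>" for r by (simp add: o_def)
    then show "(\<lambda>z. \<Sum>r<N. z ^ r * g r (z ^ N)) holomorphic_on ?\<Omega>"
      by (intro holomorphic_intros)
    show "(\<lambda>z. of_nat N powr s * f z) holomorphic_on ?\<Omega>"
      by (intro holomorphic_intros holomorphic_on_subset[OF f(1) sub])
    fix z :: complex assume "z \<in> ball 0 1"
    then have z: "norm z < 1" by simp
    then have "norm (z ^ N) < 1" using N by (simp add: norm_power power_less_one_iff)
    then show "(\<Sum>r<N. z ^ r * g r (z ^ N)) = of_nat N powr s * f z"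
      using lerch_series_multiplication[OF v N, of z s] z f(2) g(2) by (simp add: w_def)
  qed (use z in auto)
  moreover have "lerch_phi z s v = f z"
    using z sub zs by (intro lerch_phi_eq_slit_plane_continuation f) auto
  moreover have "lerch_phi (z ^ N) s (w r) = g r (z ^ N)" for r
  proof (intro lerch_phi_eq_slit_plane_continuation g z)
    have "norm (z ^ N) \<ge> 1" using zs by (simp add: norm_power one_le_power)
    moreover have "norm z = 1" if "norm (z ^ N) = 1"
      using power_eq_1_iff[of "norm z" N] that N by (simp add: norm_power)
    ultimately show "\<not> (norm (z ^ N) < 1 \<or> norm (z ^ N) = 1 \<and> Re s > 1)"
      using zs by auto
  qed
  ultimately show ?thesis by (simp add: w_def)
qed

text \<open>Here \<open>lerch_phi z s v\<close> is a continuation in \<open>z\<close> at fixed \<open>s\<close>, whereas \<open>g\<close> is a continuation in \<open>s\<close> at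
  fixed \<open>z\<close>. Both are compared with the function of \<open>lerch_closed_disc_continuation\<close>: with \<open>g\<close> through the
  identity theorem in \<open>s\<close>, and with the continuation in \<open>z\<close> through the common radial limit.\<close>

lemma lerch_phi_unit_circle_by_exponent:
  assumes v: "v \<notin> \<int>\<^sub>\<le>\<^sub>0" and z: "norm z = 1" "z \<noteq> 1" and s: "Re s \<le> 1" "s \<noteq> 1"
    and g: "g holomorphic_on - {1}" "\<And>s. Re s > 1 \<Longrightarrow> g s = lerch_series z s v"
  shows "lerch_phi z s v = g s"
proof -
  let ?D = "cball 0 1 - {1 :: complex}"
  have zD: "z \<in> ?D" using z by simp
  obtain N :: nat where N: "real N > 1 - Re s" using reals_Archimedean2 by blast
  obtain b where hol: "b z holomorphic_on {s. Re s > 1 - real N}"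
    and eq: "\<And>z s. z \<in> ?D \<Longrightarrow> norm z < 1 \<and> Re s > 1 - real N \<or> norm z = 1 \<and> Re s > 1 \<Longrightarrow>
        b z s = lerch_series z s v"
    and cont: "continuous_on ?D (\<lambda>z. b z s)"
  proof -
    obtain b where "(\<forall>z\<in>?D. b z holomorphic_on {s. Re s > 1 - real N}) \<and>
      (\<forall>z\<in>?D. \<forall>s. norm z < 1 \<and> Re s > 1 - real N \<or> norm z = 1 \<and> Re s > 1 \<longrightarrow>
        b z s = lerch_series z s v) \<and>
      (\<forall>s. Re s > 1 - real N \<longrightarrow> continuous_on ?D (\<lambda>z. b z s))"
      using lerch_closed_disc_continuation[OF v] by blast
    then show ?thesis using zD N by (intro that[of b]) auto
  qed
  have "g s = b z s"
  proof (rule analytic_continuation_open[of "{s. Re s > 1}" "{s. Re s > 1 - real N} - {1}" g "b z" s])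
    show "open ({s. Re s > 1 - real N} - {1})" by (intro open_delete open_halfspace_Re_gt)
    show "connected ({s. Re s > 1 - real N} - {1})"
      by (intro connected_open_delete convex_connected convex_halfspace_Re_gt open_halfspace_Re_gt) simp
    show "{s. Re s > 1} \<noteq> {}" by (auto intro: exI[of _ 2])
    show "{s. Re s > 1} \<subseteq> {s. Re s > 1 - real N} - {1}" by auto
    show "g holomorphic_on {s. Re s > 1 - real N} - {1}" by (rule holomorphic_on_subset[OF g(1)]) auto
    show "b z holomorphic_on {s. Re s > 1 - real N} - {1}" by (rule holomorphic_on_subset[OF hol]) auto
    show "g s = b z s" if "s \<in> {s. Re s > 1}" for s
      using that g(2) eq[OF zD] z by simp
  qed (use N s open_halfspace_Re_gt in auto)
  obtain f where f: "f holomorphic_on slit_plane" "\<And>z. norm z < 1 \<Longrightarrow> f z = lerch_series z s v"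
    using lerch_slit_plane_continuation[OF v] by blast
  have zslit: "z \<in> slit_plane"
  proof
    assume "z \<in> complex_of_real ` {1..}"
    then show False using z by auto
  qed
  \<comment> \<open>Points of the open disc that tend radially to \<open>z\<close>.\<close>
  define \<zeta> where "\<zeta> = (\<lambda>n. of_real (1 - 1 / real (Suc n)) * z)"
  have norm_\<zeta>: "norm (\<zeta> n) < 1" for n
  proof -
    have "0 < 1 / real (Suc n)" "1 / real (Suc n) \<le> 1" by (simp_all add: field_simps)
    then show ?thesis unfolding \<zeta>_def norm_mult norm_of_real z mult_1_right by linarith
  qed
  have \<zeta>D: "\<zeta> n \<in> ?D" for n using norm_\<zeta>[of n] by auto
  have "(\<lambda>n. of_real (1 - 1 / real (Suc n)) * z) \<longlonglongrightarrow> of_real (1 - 0) * z"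
    by (intro tendsto_intros LIMSEQ_Suc lim_1_over_n)
  then have lim: "\<zeta> \<longlonglongrightarrow> z" by (simp add: \<zeta>_def)
  have "(\<lambda>n. b (\<zeta> n) s) \<longlonglongrightarrow> b z s"
    by (rule continuous_on_tendsto_compose[OF cont lim zD])
       (use \<zeta>D in \<open>blast intro: always_eventually\<close>)
  moreover have "(\<lambda>n. f (\<zeta> n)) \<longlonglongrightarrow> f z"
    by (rule continuous_on_tendsto_compose[OF holomorphic_on_imp_continuous_on[OF f(1)] lim zslit])
       (use norm_\<zeta> unit_disc_subset_slit_plane in \<open>blast intro: always_eventually\<close>)
  moreover have "b (\<zeta> n) s = f (\<zeta> n)" for n
    using eq[OF \<zeta>D, of n s] norm_\<zeta>[of n] N f(2) by simp
  ultimately have "b z s = f z" using LIMSEQ_unique by auto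
  moreover have "lerch_phi z s v = f z"
    by (rule lerch_phi_eq_slit_plane_continuation[OF f zslit]) (use z s in auto)
  ultimately show ?thesis using \<open>g s = b z s\<close> by simp
qed

lemma lerch_phi_one:
  assumes "s \<noteq> 1" "Re s \<le> 1"
  shows "lerch_phi 1 s v = hurwitz_zeta s v"
  using assms by (simp add: lerch_phi_def)

text \<open>All summands on the left are now Hurwitz zeta values, which are defined by continuation in \<open>s\<close>.
  Their combination is holomorphic in \<open>s\<close> and equals the Lerch series at \<open>z\<close> for \<open>Re s > 1\<close>; so it is the
  Hurwitz zeta function again if \<open>z = 1\<close>, and otherwise the Lerch function by the preceding lemma.\<close>

lemma lerch_phi_multiplication_root_of_unity:
  assumes v: "v \<notin> \<int>\<^sub>\<le>\<^sub>0" and N: "N > 0" and z: "z ^ N = 1" and s: "Re s \<le> 1" "s \<noteq> 1"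
  shows "(\<Sum>r<N. z ^ r * lerch_phi (z ^ N) s ((v + of_nat r) / of_nat N)) =
           of_nat N powr s * lerch_phi z s v"
proof -
  define w where "w = (\<lambda>r. (v + of_nat r) / of_nat N)"
  have w: "w r \<notin> \<int>\<^sub>\<le>\<^sub>0" for r unfolding w_def by (rule divided_shift_notin_nonpos_Ints[OF v N])
  have nz: "norm z = 1"
    using power_eq_1_iff[OF z] N by simp
  obtain h where h: "\<And>r. h r holomorphic_on - {1}"
      "\<And>r s. Re s > 1 \<Longrightarrow> h r s = lerch_series 1 s (w r)"
    using hurwitz_continuation[OF w] by metis
  define g where "g = (\<lambda>s. (\<Sum>r<N. z ^ r * h r s) / of_nat N powr s)"
  have g_hol: "g holomorphic_on - {1}"
    unfolding g_def using N by (intro holomorphic_intros h) auto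
  have g_eq: "g s = lerch_series z s v" if "Re s > 1" for s
    using lerch_series_multiplication[OF v N, of z s] nz that z h(2)[OF that] N
    by (simp add: g_def w_def)
  have "lerch_phi z s v = g s"
  proof (cases "z = 1")
    case True
    then show ?thesis
      using hurwitz_zeta_eq_continuation[OF g_hol, of v s] g_eq s by (simp add: lerch_phi_one)
  next
    case False
    then show ?thesis
      using lerch_phi_unit_circle_by_exponent[OF v nz _ s g_hol] g_eq by blast
  qed
  moreover have "lerch_phi (z ^ N) s (w r) = h r s" for r
    using hurwitz_zeta_eq_continuation[OF h(1), of r "w r" s] h(2) s z by (simp add: lerch_phi_one)
  ultimately show ?thesis using N by (simp add: g_def w_def)
qed

text \<open>The hypotheses on \<open>z ^ N\<close> exclude the open cut and the pole. They are inherited by \<open>z\<close>, since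
  a real \<open>z > 1\<close> would have \<open>z ^ N > 1\<close>.\<close>

theorem lerch_phi_multiplication:
  assumes v: "v \<notin> \<int>\<^sub>\<le>\<^sub>0" and N: "N > 0"
    and z: "z ^ N \<notin> complex_of_real ` {1<..}" "\<not> (z ^ N = 1 \<and> s = 1)"
  shows "(\<Sum>r<N. z ^ r * lerch_phi (z ^ N) s ((v + of_nat r) / of_nat N)) =
           of_nat N powr s * lerch_phi z s v"
proof (cases "norm z < 1 \<or> norm z = 1 \<and> Re s > 1")
  case True
  then have "norm (z ^ N) < 1 \<or> norm (z ^ N) = 1 \<and> Re s > 1"
    using N by (auto simp: norm_power power_less_one_iff)
  with True show ?thesis
    using lerch_series_multiplication[OF v N True] by (simp add: lerch_phi_def)
next
  case False
  show ?thesis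
  proof (cases "z ^ N = 1")
    case True
    then have "norm z = 1"
      using power_eq_1_iff N by blast
    with False z True show ?thesis
      by (intro lerch_phi_multiplication_root_of_unity[OF v N True]) auto
  next
    case nz: False
    have "z ^ N \<in> slit_plane"
    proof
      assume "z ^ N \<in> complex_of_real ` {1..}"
      then obtain x where "x \<ge> 1" "z ^ N = of_real x" by auto
      then show False using nz z by (cases "x = 1") auto
    qed
    then show ?thesis by (rule lerch_phi_multiplication_slit_plane[OF v N _ False])
  qed
qed

section \<open>The alternating sum\<close>

text \<open>Pairs \<open>r = p\<close> with its mirror image \<open>r = 2 n - 1 - p\<close>.\<close>

lemma sum_lessThan_double_reflect:
  fixes F :: "nat \<Rightarrow> 'a::comm_monoid_add"
  shows "(\<Sum>r<2 * n. F r) = (\<Sum>p<n. F p + F (2 * n - 1 - p))"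
proof -
  have "(\<Sum>r<2 * n. F r) = (\<Sum>r<n. F r) + (\<Sum>r\<in>{n..<2 * n}. F r)"
    by (subst sum.union_disjoint[symmetric]) (auto intro: sum.cong)
  also have "(\<Sum>r\<in>{n..<2 * n}. F r) = (\<Sum>p<n. F (2 * n - 1 - p))"
    by (rule sum.reindex_bij_witness[of _ "\<lambda>p. 2 * n - 1 - p" "\<lambda>r. 2 * n - 1 - r"]) auto
  finally show ?thesis by (simp add: sum.distrib)
qed

text \<open>With \<open>q = exp e\<close>, the four terms for \<open>p\<close> are the contributions of \<open>r = p\<close> and of \<open>r = 2 n - 1 - p\<close> to the
  two sums on the right: the prefactor \<open>q ^ (-p)\<close> turns the four exponentials into \<open>q ^ (-r)\<close> and
  \<open>q ^ (r + 1)\<close>, and the minus signs reflect that the two values of \<open>r\<close> have opposite parity.\<close>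

lemma alternating_sum_pairing:
  fixes A B :: "nat \<Rightarrow> complex"
  shows "(\<Sum>p<n. (- 1) ^ p * exp (- (of_nat p * e)) *
            (exp ((1 - 2 * of_nat n + 2 * of_nat p) * e) * A (2 * n - 1 - p) - A p
             - exp (of_nat (2 * n) * e) * B (2 * n - 1 - p) + exp ((1 + 2 * of_nat p) * e) * B p)) =
         - (\<Sum>r<2 * n. (- exp (- e)) ^ r * A r) + exp e * (\<Sum>r<2 * n. (- exp e) ^ r * B r)"
proof -
  define F where "F = (\<lambda>r. - ((- exp (- e)) ^ r * A r) + exp e * ((- exp e) ^ r * B r))"
  have F: "F r = (- 1) ^ r * (- (exp (- (of_nat r * e)) * A r) + exp ((1 + of_nat r) * e) * B r)" for r
  proof -
    have 1: "(- exp (- e)) ^ r = (- 1) ^ r * exp (- (of_nat r * e))"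
      by (subst power_minus) (simp add: exp_of_nat_mult[symmetric])
    have 2: "exp e * (- exp e) ^ r = (- 1) ^ r * exp ((1 + of_nat r) * e)"
      by (subst power_minus) (simp add: exp_of_nat_mult[symmetric] exp_add distrib_right)
    have "F r = - ((- exp (- e)) ^ r * A r) + (exp e * (- exp e) ^ r) * B r"
      by (simp add: F_def)
    then show ?thesis unfolding 1 2 by (simp add: algebra_simps)
  qed
  have "(- 1) ^ p * exp (- (of_nat p * e)) *
            (exp ((1 - 2 * of_nat n + 2 * of_nat p) * e) * A (2 * n - 1 - p) - A p
             - exp (of_nat (2 * n) * e) * B (2 * n - 1 - p) + exp ((1 + 2 * of_nat p) * e) * B p) =
        F p + F (2 * n - 1 - p)" if "p < n" for p
  proof -
    define r where "r = 2 * n - 1 - p"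
    have rp: "r + p + 1 = 2 * n" using that by (simp add: r_def)
    have r: "of_nat r = 2 * of_nat n - 1 - (of_nat p :: complex)"
      unfolding r_def using that by (simp add: of_nat_diff)
    have "odd (r + p)" using rp by presburger
    then have sign: "(- 1) ^ r = - ((- 1) ^ p :: complex)" by (auto simp: minus_one_power_iff)
    have e1: "exp (- (of_nat p * e)) * exp ((1 - 2 * of_nat n + 2 * of_nat p) * e) = exp (- (of_nat r * e))"
      unfolding exp_add[symmetric] r by (simp add: algebra_simps)
    have e2: "exp (- (of_nat p * e)) * exp (of_nat (2 * n) * e) = exp ((1 + of_nat r) * e)"
      unfolding exp_add[symmetric] r by (simp add: algebra_simps)
    have e3: "exp (- (of_nat p * e)) * exp ((1 + 2 * of_nat p) * e) = exp ((1 + of_nat p) * e)"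
      unfolding exp_add[symmetric] by (simp add: algebra_simps)
    have "(- 1) ^ p * exp (- (of_nat p * e)) *
            (exp ((1 - 2 * of_nat n + 2 * of_nat p) * e) * A r - A p
             - exp (of_nat (2 * n) * e) * B r + exp ((1 + 2 * of_nat p) * e) * B p) =
        (- 1) ^ p * ((exp (- (of_nat p * e)) * exp ((1 - 2 * of_nat n + 2 * of_nat p) * e)) * A r
          - exp (- (of_nat p * e)) * A p - (exp (- (of_nat p * e)) * exp (of_nat (2 * n) * e)) * B r
          + (exp (- (of_nat p * e)) * exp ((1 + 2 * of_nat p) * e)) * B p)"
      by (simp only: ring_distribs mult_ac)
    also have "\<dots> = F p + F r"
      unfolding e1 e2 e3 F sign by (simp add: algebra_simps)
    finally show ?thesis unfolding r_def .
  qed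
  then have "(\<Sum>p<n. (- 1) ^ p * exp (- (of_nat p * e)) *
            (exp ((1 - 2 * of_nat n + 2 * of_nat p) * e) * A (2 * n - 1 - p) - A p
             - exp (of_nat (2 * n) * e) * B (2 * n - 1 - p) + exp ((1 + 2 * of_nat p) * e) * B p)) =
        (\<Sum>p<n. F p + F (2 * n - 1 - p))"
    by (intro sum.cong) auto
  also have "\<dots> = (\<Sum>r<2 * n. F r)" by (rule sum_lessThan_double_reflect[symmetric])
  also have "\<dots> = - (\<Sum>r<2 * n. (- exp (- e)) ^ r * A r) + exp e * (\<Sum>r<2 * n. (- exp e) ^ r * B r)"
    by (simp add: F_def sum.distrib sum_negf sum_subtractf sum_distrib_left)
  finally show ?thesis .
qed

theorem theorem4p105:
  fixes n :: nat and k m a \<alpha> :: complex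
  assumes "n > 0" and "\<alpha> \<noteq> 0"
    and "\<And>p. p < n \<Longrightarrow> lerch_defined (exp (- (2 * \<i> * m * of_real pi / \<alpha>))) (- k)
           (1 - (1 + 2 * of_nat p) / (4 * of_nat n) + a * \<alpha> / 2)"
    and "\<And>p. p < n \<Longrightarrow> lerch_defined (exp (- (2 * \<i> * m * of_real pi / \<alpha>))) (- k)
           ((1 + 2 * of_nat p + 2 * a * of_nat n * \<alpha>) / (4 * of_nat n))"
    and "\<And>p. p < n \<Longrightarrow> lerch_defined (exp (2 * \<i> * m * of_real pi / \<alpha>)) (- k)
           (1 - (1 + 2 * of_nat p) / (4 * of_nat n) + a * \<alpha> / 2)"
    and "\<And>p. p < n \<Longrightarrow> lerch_defined (exp (2 * \<i> * m * of_real pi / \<alpha>)) (- k)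
           ((1 + 2 * of_nat p + 2 * a * of_nat n * \<alpha>) / (4 * of_nat n))"
    and "lerch_defined (- exp (- (\<i> * m * of_real pi / (of_nat n * \<alpha>)))) (- k)
           (1 / 2 + a * of_nat n * \<alpha>)"
    and "lerch_defined (- exp (\<i> * m * of_real pi / (of_nat n * \<alpha>))) (- k)
           (1 / 2 + a * of_nat n * \<alpha>)"
  shows
    "(\<Sum>p = 0..<n. (- 1) ^ p * exp (- (\<i> * m * of_nat p * of_real pi / (of_nat n * \<alpha>))) *
        (exp (\<i> * m * (1 - 2 * of_nat n + 2 * of_nat p) * of_real pi / (of_nat n * \<alpha>)) *
           lerch_phi (exp (- (2 * \<i> * m * of_real pi / \<alpha>))) (- k)
             (1 - (1 + 2 * of_nat p) / (4 * of_nat n) + a * \<alpha> / 2)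
         - lerch_phi (exp (- (2 * \<i> * m * of_real pi / \<alpha>))) (- k)
             ((1 + 2 * of_nat p + 2 * a * of_nat n * \<alpha>) / (4 * of_nat n))
         - exp (2 * \<i> * m * of_real pi / \<alpha>) *
           lerch_phi (exp (2 * \<i> * m * of_real pi / \<alpha>)) (- k)
             (1 - (1 + 2 * of_nat p) / (4 * of_nat n) + a * \<alpha> / 2)
         + exp (\<i> * m * (1 + 2 * of_nat p) * of_real pi / (of_nat n * \<alpha>)) *
           lerch_phi (exp (2 * \<i> * m * of_real pi / \<alpha>)) (- k)
             ((1 + 2 * of_nat p + 2 * a * of_nat n * \<alpha>) / (4 * of_nat n))))
     = (1 / (2 * of_nat n)) powr k *
        (- lerch_phi (- exp (- (\<i> * m * of_real pi / (of_nat n * \<alpha>)))) (- k)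
             (1 / 2 + a * of_nat n * \<alpha>)
         + exp (\<i> * m * of_real pi / (of_nat n * \<alpha>)) *
           lerch_phi (- exp (\<i> * m * of_real pi / (of_nat n * \<alpha>))) (- k)
             (1 / 2 + a * of_nat n * \<alpha>))"
proof -
  define N where "N = 2 * n"
  define s where "s = - k"
  define e where "e = \<i> * m * of_real pi / (of_nat n * \<alpha>)"
  define v where "v = 1 / 2 + a * of_nat n * \<alpha>"
  define A where "A = (\<lambda>r. lerch_phi (exp (- (of_nat N * e))) s ((v + of_nat r) / of_nat N))"
  define B where "B = (\<lambda>r. lerch_phi (exp (of_nat N * e)) s ((v + of_nat r) / of_nat N))"
  have n: "n > 0" and n0: "of_nat n \<noteq> (0::complex)" and N: "N > 0"
    using assms(1) by (auto simp: N_def)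
  have Ne: "2 * \<i> * m * of_real pi / \<alpha> = of_nat N * e"
    using n0 assms(2) by (simp add: N_def e_def)
  have v_lo: "(1 + 2 * of_nat p + 2 * a * of_nat n * \<alpha>) / (4 * of_nat n) = (v + of_nat p) / of_nat N" for p
    using n0 by (simp add: N_def v_def field_simps)
  have v_hi: "1 - (1 + 2 * of_nat p) / (4 * of_nat n) + a * \<alpha> / 2 = (v + of_nat (2 * n - 1 - p)) / of_nat N"
    if "p < n" for p
  proof -
    have "of_nat (2 * n - 1 - p) = 2 * of_nat n - 1 - (of_nat p :: complex)"
      using that by (simp add: of_nat_diff)
    then show ?thesis unfolding N_def v_def using n0 by (simp only:) (simp add: field_simps)
  qed
  have v: "v \<notin> \<int>\<^sub>\<le>\<^sub>0" using assms(7) by (simp add: lerch_defined_def v_def)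
  have pw: "(- exp x) ^ N = exp (of_nat N * x)" for x :: complex
    by (simp add: N_def exp_of_nat_mult power_minus_even del: of_nat_mult)
  have A_sum: "(\<Sum>r<N. (- exp (- e)) ^ r * A r) = of_nat N powr s * lerch_phi (- exp (- e)) s v"
    using lerch_phi_multiplication[OF v N, of "- exp (- e)" s] assms(4)[OF n]
    unfolding pw A_def Ne by (simp add: lerch_defined_def s_def)
  have B_sum: "(\<Sum>r<N. (- exp e) ^ r * B r) = of_nat N powr s * lerch_phi (- exp e) s v"
    using lerch_phi_multiplication[OF v N, of "- exp e" s] assms(6)[OF n]
    unfolding pw B_def Ne by (simp add: lerch_defined_def s_def)
  have scale: "(1 / (2 * of_nat n)) powr k = of_nat N powr s"
  proof -
    have "(of_nat N :: complex) \<notin> \<real>\<^sub>\<le>\<^sub>0"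
      using N by (simp add: complex_nonpos_Reals_iff)
    then have ln: "Ln (inverse (of_nat N)) = - Ln (of_nat N)" by (rule Ln_inverse)
    have inv: "1 / (2 * of_nat n) = inverse (of_nat N :: complex)"
      by (simp only: N_def inverse_eq_divide of_nat_mult of_nat_numeral)
    show ?thesis
      unfolding inv powr_def ln using N by (simp add: s_def)
  qed
  have e_mult: "\<i> * m * x * of_real pi / (of_nat n * \<alpha>) = x * e" for x
    by (simp add: e_def)
  have rhs: "of_nat N powr s * (- lerch_phi (- exp (- e)) s v + exp e * lerch_phi (- exp e) s v) =
      - (\<Sum>r<N. (- exp (- e)) ^ r * A r) + exp e * (\<Sum>r<N. (- exp e) ^ r * B r)"
    unfolding A_sum B_sum by (simp add: algebra_simps)
  show ?thesis
    unfolding Ne e_mult e_def[symmetric] v_lo scale v_def[symmetric] s_def[symmetric] rhs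
    unfolding N_def alternating_sum_pairing[symmetric]
    by (intro sum.cong) (auto simp only: v_hi A_def B_def N_def atLeastLessThan_iff lessThan_iff)
qed

end
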